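(* Suppose that $p$ is a prime, $F_1,F_2$ are non-abelian free groups and $G\leqslant F_1\times F_2$ is a subdirect product of finite index. Then the following are equivalent: (1) $G$ is $p$-conjugacy separable; (2) $F_1/N_1$ is a finite $p$-group, where $N_1:=G\cap F_1$; (3) the index $|(F_1\times F_2):G|$ is a power of $p$.
   Context: A group $G$ is $p$-conjugacy separable if for any two non-conjugate elements $x,y\in G$ there is a homomorphism $\varphi$ from $G$ to a finite $p$-group $M$ such that $\varphi(x)$ and $\varphi(y)$ are not conjugate in $M$. In $F_1\times F_2$ one identifies $F_1$ with $F_1\times\{1\}$ and $F_2$ with $\{1\}\times F_2$. A subgroup $G\leqslant F_1\times F_2$ is a subdirect product if both coordinate projections map $G$ onto $F_1$ and $F_2$ respectively; then $G\cap F_i\lhd F_i$. The trivial group is a finite $p$-group, and $1=p^0$ is a power of $p$. *)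

theory Defs
  imports "HOL-Algebra.Algebra"
begin

text \<open>A word is a list of signed letters: the pair of \<open>x\<close> and \<open>True\<close> stands for \<open>x\<close>,
  the pair of \<open>x\<close> and \<open>False\<close> for its inverse.\<close>

fun word_val :: "('a, 'm) monoid_scheme \<Rightarrow> ('a \<times> bool) list \<Rightarrow> 'a" where
  "word_val F [] = \<one>\<^bsub>F\<^esub>"
| "word_val F ((x, b) # w) = (if b then x else inv\<^bsub>F\<^esub> x) \<otimes>\<^bsub>F\<^esub> word_val F w"

definition reduced_word :: "('a \<times> bool) list \<Rightarrow> bool" where
  "reduced_word w \<longleftrightarrow> successively (\<lambda>(x, a) (y, b). \<not> (x = y \<and> a \<noteq> b)) w"

definition free_basis :: "('a, 'm) monoid_scheme \<Rightarrow> 'a set \<Rightarrow> bool" where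
  "free_basis F S \<longleftrightarrow> S \<subseteq> carrier F \<and>
     bij_betw (word_val F) {w \<in> lists (S \<times> UNIV). reduced_word w} (carrier F)"

definition is_free_group :: "('a, 'm) monoid_scheme \<Rightarrow> bool" where
  "is_free_group F \<longleftrightarrow> group F \<and> (\<exists>S. free_basis F S)"

definition conjugate_in :: "('a, 'm) monoid_scheme \<Rightarrow> 'a \<Rightarrow> 'a \<Rightarrow> bool" where
  "conjugate_in G x y \<longleftrightarrow> (\<exists>g \<in> carrier G. y = g \<otimes>\<^bsub>G\<^esub> x \<otimes>\<^bsub>G\<^esub> inv\<^bsub>G\<^esub> g)"

definition finite_p_group :: "nat \<Rightarrow> ('a, 'm) monoid_scheme \<Rightarrow> bool" where
  "finite_p_group p M \<longleftrightarrow> group M \<and> finite (carrier M) \<and> (\<exists>k. order M = p ^ k)"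

text \<open>HOL cannot quantify over the carrier types of the groups \<open>M\<close>. Every finite group has a
  copy on a set of natural numbers, so \<^typ>\<open>nat\<close> loses nothing; see
  \<open>finite_p_quotient_on_nat\<close> below.\<close>

definition p_conjugacy_separable :: "nat \<Rightarrow> ('a, 'm) monoid_scheme \<Rightarrow> bool" where
  "p_conjugacy_separable p G \<longleftrightarrow>
     (\<forall>x \<in> carrier G. \<forall>y \<in> carrier G. \<not> conjugate_in G x y \<longrightarrow>
        (\<exists>(M :: nat monoid) \<phi>. finite_p_group p M \<and> \<phi> \<in> hom G M \<and>
           \<not> conjugate_in M (\<phi> x) (\<phi> y)))"

lemma finite_p_quotient_on_nat:
  fixes M :: "'b monoid"
  assumes M: "finite_p_group p M" and \<phi>: "\<phi> \<in> hom G M"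
    and xy: "x \<in> carrier G" "y \<in> carrier G" "\<not> conjugate_in M (\<phi> x) (\<phi> y)"
  shows "\<exists>(K :: nat monoid) \<psi>. finite_p_group p K \<and> \<psi> \<in> hom G K \<and>
           \<not> conjugate_in K (\<psi> x) (\<psi> y)"
proof -
  interpret M: group M using M by (simp add: finite_p_group_def)
  obtain f :: "'b \<Rightarrow> nat" where f: "inj_on f (carrier M)"
    using M finite_imp_inj_to_nat_seg unfolding finite_p_group_def by blast
  define K where "K = \<lparr>carrier = f ` carrier M,
    monoid.mult = (\<lambda>a b. f (inv_into (carrier M) f a \<otimes>\<^bsub>M\<^esub> inv_into (carrier M) f b)),
    one = f \<one>\<^bsub>M\<^esub>\<rparr>"
  have f_iso: "f \<in> iso M K"
    using f by (simp add: iso_def hom_def K_def bij_betw_def)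
  have carrier_K: "carrier K = f ` carrier M" by (simp add: K_def)
  have "M \<cong> K" using f_iso by (rule is_isoI)
  have "K\<lparr>one := f \<one>\<^bsub>M\<^esub>\<rparr> = K" by (simp add: K_def)
  with M.iso_imp_img_group [OF f_iso] have K: "group K" by simp
  interpret h: group_hom M K f
    using K f_iso M.is_group by (simp add: group_hom_def group_hom_axioms_def iso_def)
  have "finite_p_group p K"
    using M K iso_same_card [OF \<open>M \<cong> K\<close>] iso_finite [OF \<open>M \<cong> K\<close>]
    by (simp add: finite_p_group_def order_def)
  moreover have "f \<circ> \<phi> \<in> hom G K"
    using \<phi> h.homh by (rule hom_compose)
  moreover have "\<not> conjugate_in K ((f \<circ> \<phi>) x) ((f \<circ> \<phi>) y)"
  proof
    assume "conjugate_in K ((f \<circ> \<phi>) x) ((f \<circ> \<phi>) y)"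
    then obtain m where m: "m \<in> carrier M"
      and eq: "f (\<phi> y) = f m \<otimes>\<^bsub>K\<^esub> f (\<phi> x) \<otimes>\<^bsub>K\<^esub> inv\<^bsub>K\<^esub> (f m)"
      unfolding conjugate_in_def carrier_K comp_apply by blast
    have in_M: "\<phi> x \<in> carrier M" "\<phi> y \<in> carrier M"
      using \<phi> xy by (auto simp: hom_def)
    have "f (\<phi> y) = f (m \<otimes>\<^bsub>M\<^esub> \<phi> x \<otimes>\<^bsub>M\<^esub> inv\<^bsub>M\<^esub> m)"
      unfolding eq using m in_M by simp
    then have "\<phi> y = m \<otimes>\<^bsub>M\<^esub> \<phi> x \<otimes>\<^bsub>M\<^esub> inv\<^bsub>M\<^esub> m"
      by (rule inj_onD [OF f]) (use m in_M in simp_all)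
    then show False using xy m unfolding conjugate_in_def by blast
  qed
  ultimately show ?thesis by blast
qed

definition subdirect_product ::
  "('a, 'm) monoid_scheme \<Rightarrow> ('b, 'n) monoid_scheme \<Rightarrow> ('a \<times> 'b) set \<Rightarrow> bool" where
  "subdirect_product F1 F2 G \<longleftrightarrow>
     subgroup G (F1 \<times>\<times> F2) \<and> fst ` G = carrier F1 \<and> snd ` G = carrier F2"

text \<open>\<open>G \<inter> F\<^sub>1\<close>, where \<open>F\<^sub>1\<close> is identified with \<open>F\<^sub>1 \<times> {1}\<close>; the projection \<open>fst\<close> carries
  the intersection back into \<open>F\<^sub>1\<close>.\<close>

definition meet_fst_factor ::
  "('a, 'm) monoid_scheme \<Rightarrow> ('b, 'n) monoid_scheme \<Rightarrow> ('a \<times> 'b) set \<Rightarrow> 'a set" where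
  "meet_fst_factor F1 F2 G = fst ` (G \<inter> carrier F1 \<times> {\<one>\<^bsub>F2\<^esub>})"

end

theory Submission
  imports Defs
begin

text \<open>Write \<open>Q\<close> for \<open>F1 / N1\<close>, which is isomorphic to \<open>F2 / N2\<close>; then \<open>G\<close> is the fibre product of
  \<open>F1\<close> and \<open>F2\<close> over \<open>Q\<close>, and its index is the order of \<open>Q\<close>.

  If \<open>Q\<close> is not a \<open>p\<close>-group, take \<open>f\<close> of order prime to \<open>p\<close> in \<open>Q\<close>, and \<open>xi\<close> in \<open>Ni\<close> with centralizer
  inside \<open>Ni\<close>. Then \<open>(x1, x2)\<close> and \<open>(f x1 f\<^sup>-\<^sup>1, x2)\<close> are not conjugate in \<open>G\<close>, but they are in every
  finite \<open>p\<close>-quotient of \<open>G\<close>.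

  If \<open>Q\<close> is a finite \<open>p\<close>-group, it suffices to find for \<open>x\<close>, \<open>y\<close> in a free group \<open>F\<close> and a normal subgroup
  \<open>K\<close> of \<open>p\<close>-power index another one, \<open>L\<close>, such that \<open>g x g\<^sup>-\<^sup>1 = y\<close> modulo \<open>L\<close> implies \<open>h x h\<^sup>-\<^sup>1 = y\<close> for
  some \<open>h\<close> in \<open>g K\<close>. This \<open>L\<close> is reached from \<open>K\<close> by passing repeatedly from \<open>L\<close> to the kernel of
  the map to the homology modulo \<open>p\<^sup>N\<close> of the Cayley graph of \<open>F / L\<close>. After many steps, short words
  are trivial modulo \<open>L\<close> only if they are trivial, and the closed path of a power of \<open>x\<close> has a nonzero
  flow through its first edge. The corresponding path of \<open>y\<close> from \<open>g\<^sup>-\<^sup>1\<close> then meets this edge, and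
  up to powers of \<open>y\<close> this expresses \<open>g\<close> modulo \<open>L\<close> by a prefix of \<open>y\<close>.\<close>

section \<open>Groups and finite \<open>p\<close>-groups\<close>

lemma finite_image_if_factors:
  assumes "finite (f ` A)" and "\<And>x y. x \<in> A \<Longrightarrow> y \<in> A \<Longrightarrow> f x = f y \<Longrightarrow> g x = g y"
  shows "finite (g ` A)"
proof (rule finite_subset)
  show "g ` A \<subseteq> (\<lambda>v. g (inv_into A f v)) ` f ` A"
  proof
    fix v assume "v \<in> g ` A"
    then obtain x where x: "x \<in> A" "v = g x" by blast
    then have "g x = g (inv_into A f (f x))"
      by (intro assms(2)) (auto simp: inv_into_into f_inv_into_f)
    with x show "v \<in> (\<lambda>v. g (inv_into A f v)) ` f ` A" by blast
  qed
qed (use assms(1) in simp)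

lemma sum_of_bool_le_1:
  assumes "finite B" "\<And>i j. i \<in> B \<Longrightarrow> j \<in> B \<Longrightarrow> R i \<Longrightarrow> R j \<Longrightarrow> i = j"
  shows "(\<Sum>j\<in>B. of_bool (R j)) \<le> (1 :: int)"
proof (cases "\<exists>i \<in> B. R i")
  case True
  then obtain i where i: "i \<in> B" "R i" by blast
  then have "(\<Sum>j\<in>B. of_bool (R j)) = (\<Sum>j\<in>B. if j = i then 1 else (0 :: int))"
    using assms(2) by (intro sum.cong) auto
  then show ?thesis using assms(1) i by simp
qed simp

context group
begin

lemma inv_mult_cancel:
  assumes "x \<in> carrier G" "y \<in> carrier G"
  shows "inv x \<otimes> (x \<otimes> y) = y" "x \<otimes> (inv x \<otimes> y) = y"
  using assms by (simp_all flip: m_assoc)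

lemma inv_mult_nat_pow_comm:
  assumes "x \<in> carrier G"
  shows "inv x \<otimes> x [^] (n::nat) = x [^] n \<otimes> inv x"
proof -
  have "x [^] n \<otimes> x = x \<otimes> x [^] n" using nat_pow_Suc2 [OF assms, of n] by simp
  then have "inv x \<otimes> (x [^] n \<otimes> x) \<otimes> inv x = inv x \<otimes> (x \<otimes> x [^] n) \<otimes> inv x" by simp
  then show ?thesis using assms by (simp add: m_assoc inv_mult_cancel)
qed

lemma conj_nat_pow:
  assumes "g \<in> carrier G" "x \<in> carrier G"
  shows "(g \<otimes> x \<otimes> inv g) [^] (n::nat) = g \<otimes> x [^] n \<otimes> inv g"
  by (induction n) (simp_all add: assms m_assoc inv_mult_cancel)

lemma subgroup_nat_pow_closed:
  assumes "subgroup H G" "x \<in> H"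
  shows "x [^] (n::nat) \<in> H"
  by (induction n) (use assms in \<open>auto simp: subgroup.one_closed subgroup.m_closed\<close>)

lemma r_coset_eq_iff:
  assumes "subgroup H G" "x \<in> carrier G" "y \<in> carrier G"
  shows "H #> x = H #> y \<longleftrightarrow> x \<otimes> inv y \<in> H"
  using assms by (metis repr_independence repr_independenceD subgroup.rcos_module is_group)

lemma r_coset_eq_self_iff:
  assumes "subgroup H G" "x \<in> carrier G"
  shows "H #> x = H \<longleftrightarrow> x \<in> H"
  using assms coset_join1 coset_join2 by blast

text \<open>The part of the order prime to \<open>p\<close> is not 1, so it has a prime divisor
  \<open>q\<close>, different from \<open>p\<close>. Sylow's theorem for the exponent 1 gives a
  subgroup of order \<open>q\<close>, and any nontrivial element of it will do.\<close>

lemma exists_coprime_order: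
  assumes "Factorial_Ring.prime p" "finite (carrier G)" "\<nexists>k. order G = p ^ k"
  obtains x n where "x \<in> carrier G" "x \<noteq> \<one>" "x [^] (n::nat) = \<one>" "coprime n p"
proof -
  have "order G \<noteq> 0" using assms(2) by (simp add: order_gt_0_iff_finite)
  moreover have "p \<noteq> 0" "\<not> is_unit p" using assms(1) by auto
  ultimately obtain m where m: "order G = p ^ multiplicity p (order G) * m" "\<not> p dvd m"
    using multiplicity_decompose' by blast
  then have "m \<noteq> 1" using assms(3) by (metis mult.right_neutral)
  then obtain q where q: "Factorial_Ring.prime q" "q dvd m" using prime_factor_nat by blast
  with m obtain k where "order G = q ^ 1 * k" by (metis dvd_mult dvdE power_one_right)
  with q obtain H where H: "subgroup H G" "card H = q"
    using sylow_thm [OF q(1) is_group _ assms(2)] by (metis power_one_right)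
  interpret H: group "G\<lparr>carrier := H\<rparr>" using H(1) by (rule subgroup.subgroup_is_group) (rule is_group)
  have "H \<noteq> {\<one>}" using H(2) q(1) by auto
  then obtain x where x: "x \<in> H" "x \<noteq> \<one>"
    using subgroup.one_closed [OF H(1)] by blast
  have "x [^] q = \<one>"
    using H.pow_order_eq_1 [of x] x H by (simp add: order_def flip: nat_pow_consistent)
  moreover have "coprime q p" using q m assms(1) primes_coprime by blast
  ultimately show ?thesis using that x subgroup.mem_carrier [OF H(1)] by blast
qed

lemma pow_coprime_eq_one:
  assumes "x \<in> carrier G" "x [^] (m::nat) = \<one>" "x [^] (n::nat) = \<one>" "coprime m n"
  shows "x = \<one>"
proof -
  have "ord x dvd m" "ord x dvd n" using assms by (simp_all add: pow_eq_id)
  then have "ord x = 1" using assms(4) by (metis coprime_common_divisor_nat)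
  then show ?thesis using ord_eq_1 [OF assms(1)] by simp
qed

end

context normal
begin

lemma group_hom_Mod: "group_hom G (G Mod H) ((#>) H)"
  using r_coset_hom_Mod factorgroup_is_group is_group
  by (simp add: group_hom_def group_hom_axioms_def)

lemma r_coset_pow:
  assumes "x \<in> carrier G"
  shows "(H #> x) [^]\<^bsub>G Mod H\<^esub> (n::nat) = H #> x [^] n"
  using group_hom.hom_nat_pow [OF group_hom_Mod assms] by simp

lemma r_coset_pow_eq_one_iff:
  assumes "x \<in> carrier G"
  shows "(H #> x) [^]\<^bsub>G Mod H\<^esub> (n::nat) = \<one>\<^bsub>G Mod H\<^esub> \<longleftrightarrow> x [^] n \<in> H"
  using assms subgroup_axioms by (simp add: r_coset_pow r_coset_eq_self_iff)

text \<open>Turns the order into a condition on elements, which is easy to follow up the tower of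
  kernels. From right to left, an element of order prime to \<open>p\<close> given by
  \<open>exists_coprime_order\<close> would also be killed by a power of \<open>p\<close>, hence be
  trivial.\<close>

lemma finite_p_group_Mod_iff:
  assumes "Factorial_Ring.prime p"
  shows "finite_p_group p (G Mod H) \<longleftrightarrow>
    finite (rcosets H) \<and> (\<forall>x \<in> carrier G. \<exists>k. x [^] (p ^ k) \<in> H)"
proof -
  interpret Q: group "G Mod H" by (rule factorgroup_is_group)
  have carrier: "carrier (G Mod H) = rcosets H" by (simp add: FactGroup_def)
  have in_Q: "H #> x \<in> carrier (G Mod H)" if "x \<in> carrier G" for x
    using that subset by (simp add: carrier rcosetsI)
  show ?thesis
  proof (intro iffI conjI ballI)
    assume Q: "finite_p_group p (G Mod H)"
    then show "finite (rcosets H)" by (simp add: finite_p_group_def carrier)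
    obtain k where k: "order (G Mod H) = p ^ k" using Q by (auto simp: finite_p_group_def)
    fix x assume "x \<in> carrier G"
    then have "x [^] (p ^ k) \<in> H"
      using Q.pow_order_eq_1 [OF in_Q] by (simp only: r_coset_pow_eq_one_iff flip: k)
    then show "\<exists>k. x [^] (p ^ k) \<in> H" by blast
  next
    assume *: "finite (rcosets H) \<and> (\<forall>x \<in> carrier G. \<exists>k. x [^] (p ^ k) \<in> H)"
    have "\<exists>k. order (G Mod H) = p ^ k"
    proof (rule ccontr)
      assume "\<nexists>k. order (G Mod H) = p ^ k"
      then obtain c n where c: "c \<in> carrier (G Mod H)" "c \<noteq> \<one>\<^bsub>G Mod H\<^esub>"
        "c [^]\<^bsub>G Mod H\<^esub> (n::nat) = \<one>\<^bsub>G Mod H\<^esub>" "coprime n p"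
        using Q.exists_coprime_order [OF assms] * carrier by metis
      obtain x where x: "x \<in> carrier G" "c = H #> x"
        using c(1) by (auto simp: carrier_FactGroup)
      with * obtain k where "x [^] (p ^ k) \<in> H" by blast
      with x have "c [^]\<^bsub>G Mod H\<^esub> (p ^ k) = \<one>\<^bsub>G Mod H\<^esub>"
        by (simp only: r_coset_pow_eq_one_iff)
      then show False
        using Q.pow_coprime_eq_one [OF c(1,3)] c(2,4) by simp
    qed
    with * show "finite_p_group p (G Mod H)"
      by (simp add: finite_p_group_def carrier factorgroup_is_group)
  qed
qed

end

section \<open>Words\<close>

fun flip :: "'a \<times> bool \<Rightarrow> 'a \<times> bool" where
  "flip (x, b) = (x, \<not> b)"

lemma flip_flip [simp]: "flip (flip a) = a"
  by (cases a) auto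

lemma flip_neq [simp]: "flip a \<noteq> a" "a \<noteq> flip a"
  by (cases a; auto)+

lemma flip_eq_iff [simp]: "flip a = flip b \<longleftrightarrow> a = b"
  by (cases a; cases b) auto

lemma fst_flip [simp]: "fst (flip a) = fst a"
  by (cases a) auto

lemma reduced_word_iff: "reduced_word w \<longleftrightarrow> successively (\<lambda>a b. b \<noteq> flip a) w"
proof -
  have "(\<lambda>(x, a) (y, b). \<not> (x = y \<and> a \<noteq> b)) = (\<lambda>a b :: 'a \<times> bool. b \<noteq> flip a)"
    by (auto simp: fun_eq_iff)
  then show ?thesis by (simp add: reduced_word_def)
qed

lemma reduced_word_Nil [simp]: "reduced_word []"
  by (simp add: reduced_word_iff)

lemma reduced_word_append:
  "reduced_word (v @ w) \<longleftrightarrow> reduced_word v \<and> reduced_word w \<and>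
     (v = [] \<or> w = [] \<or> hd w \<noteq> flip (last v))"
  by (auto simp: reduced_word_iff successively_append_iff)

lemma reduced_word_Cons:
  "reduced_word (a # w) \<longleftrightarrow> reduced_word w \<and> (w = [] \<or> hd w \<noteq> flip a)"
  using reduced_word_append [of "[a]" w] by (auto simp: reduced_word_iff)

lemma reduced_word_take: "reduced_word w \<Longrightarrow> reduced_word (take i w)"
  by (metis append_take_drop_id reduced_word_append)

section \<open>Free reduction of words\<close>

fun push :: "'a \<times> bool \<Rightarrow> ('a \<times> bool) list \<Rightarrow> ('a \<times> bool) list" where
  "push a [] = [a]"
| "push a (b # w) = (if b = flip a then w else a # b # w)"

definition reduce :: "('a \<times> bool) list \<Rightarrow> ('a \<times> bool) list" where
  "reduce w = foldr push w []"

lemma reduce_Nil [simp]: "reduce [] = []"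
  and reduce_Cons [simp]: "reduce (a # w) = push a (reduce w)"
  by (simp_all add: reduce_def)

lemma reduced_word_push: "reduced_word w \<Longrightarrow> reduced_word (push a w)"
  by (cases w) (auto simp: reduced_word_Cons)

lemma reduced_word_reduce [simp]: "reduced_word (reduce w)"
  by (induction w) (auto intro: reduced_word_push)

lemma length_push: "length (push a w) \<le> Suc (length w)"
  by (cases w) auto

lemma length_reduce: "length (reduce w) \<le> length w"
  by (induction w) (auto intro: order.trans [OF length_push])

lemma set_push: "set (push a w) \<subseteq> insert a (set w)"
  by (cases w) auto

lemma set_reduce: "set (reduce w) \<subseteq> set w"
proof (induction w)
  case (Cons a w)
  then show ?case using set_push [of a "reduce w"] by auto
qed simp

definition word_inv :: "('a \<times> bool) list \<Rightarrow> ('a \<times> bool) list" where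
  "word_inv w = rev (map flip w)"

lemma length_word_inv [simp]: "length (word_inv w) = length w"
  by (simp add: word_inv_def)

lemma set_word_inv [simp]: "set (word_inv w) = flip ` set w"
  by (simp add: word_inv_def)

definition words :: "'a set \<Rightarrow> ('a \<times> bool) list set" where
  "words A = {w. fst ` set w \<subseteq> A}"

lemma words_eq_lists: "words A = lists (A \<times> UNIV)"
  by (auto simp: words_def in_lists_conv_set)

lemma Nil_in_words [simp]: "[] \<in> words A"
  and Cons_in_words [simp]: "a # w \<in> words A \<longleftrightarrow> fst a \<in> A \<and> w \<in> words A"
  and append_in_words [simp]: "v @ w \<in> words A \<longleftrightarrow> v \<in> words A \<and> w \<in> words A"
  and word_inv_in_words [simp]: "word_inv w \<in> words A \<longleftrightarrow> w \<in> words A"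
  by (auto simp: words_def image_image)

lemma take_in_words: "w \<in> words A \<Longrightarrow> take i w \<in> words A"
  unfolding words_def using set_take_subset [of i w] by blast

lemma reduce_in_words: "w \<in> words A \<Longrightarrow> reduce w \<in> words A"
  unfolding words_def using set_reduce [of w] by blast

lemma words_mono: "w \<in> words A \<Longrightarrow> A \<subseteq> B \<Longrightarrow> w \<in> words B"
  unfolding words_def by blast

text \<open>When \<open>w\<close> is reduced, \<open>w @ w\<close> can only fail to be so at the
  seam, that is, if the last letter cancels the first. The middle \<open>v\<close> is nonempty since
  a letter next to its \<open>flip\<close> is not reduced.\<close>

lemma reduced_word_cases:
  assumes "reduced_word w"
  obtains (cyclically_reduced) "reduced_word (w @ w)"
  | (conjugate) a v where "w = a # v @ [flip a]" "v \<noteq> []"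
proof (cases "reduced_word (w @ w)")
  case False
  with assms have "w \<noteq> []" and hd: "hd w = flip (last w)"
    by (auto simp: reduced_word_append)
  then obtain v b where w: "w = v @ [b]" by (metis append_butlast_last_id)
  with hd obtain a v' where v: "v = a # v'" by (cases v) auto
  with w hd have "w = a # v' @ [flip a]" by auto
  moreover from this assms have "v' \<noteq> []" by (auto simp: reduced_word_Cons)
  ultimately show ?thesis by (rule that(2))
qed (rule that(1))

context group
begin

section \<open>Values of words in a group\<close>

definition letter_val :: "'a \<times> bool \<Rightarrow> 'a" where
  "letter_val a = (if snd a then fst a else inv fst a)"

lemma word_val_Cons: "word_val G (a # w) = letter_val a \<otimes> word_val G w"
  by (cases a) (simp add: letter_val_def)

lemma letter_val_closed: "fst a \<in> carrier G \<Longrightarrow> letter_val a \<in> carrier G"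
  by (simp add: letter_val_def)

lemma letter_val_flip: "fst a \<in> carrier G \<Longrightarrow> letter_val (flip a) = inv letter_val a"
  by (cases a) (simp add: letter_val_def)

lemma word_val_closed: "w \<in> words (carrier G) \<Longrightarrow> word_val G w \<in> carrier G"
proof (induction w)
  case (Cons a w)
  then show ?case by (cases a) auto
qed simp

lemma word_val_append:
  assumes "v \<in> words (carrier G)" "w \<in> words (carrier G)"
  shows "word_val G (v @ w) = word_val G v \<otimes> word_val G w"
  using assms
proof (induction v)
  case (Cons a v)
  then show ?case
    by (auto simp: word_val_Cons m_assoc letter_val_closed word_val_closed simp del: word_val.simps)
qed (simp add: word_val_closed)

lemma word_val_inv:
  assumes "w \<in> words (carrier G)"
  shows "word_val G (word_inv w) = inv word_val G w"
  using assms
proof (induction w)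
  case (Cons a w)
  have [simp]: "letter_val a \<in> carrier G" "word_val G w \<in> carrier G"
    using Cons by (auto intro: letter_val_closed word_val_closed)
  have "word_val G (word_inv (a # w)) = word_val G (word_inv w @ [flip a])"
    by (simp add: word_inv_def)
  also have "\<dots> = inv word_val G w \<otimes> inv letter_val a"
    using Cons by (subst word_val_append)
      (auto simp: word_val_Cons letter_val_flip letter_val_closed simp del: word_val.simps(2))
  finally show ?case
    by (simp add: word_val_Cons inv_mult_group del: word_val.simps(2))
qed (simp add: word_inv_def)

lemma word_val_push:
  assumes "a # w \<in> words (carrier G)"
  shows "word_val G (push a w) = letter_val a \<otimes> word_val G w"
proof (cases w)
  case (Cons b v)
  have [simp]: "letter_val a \<in> carrier G" "word_val G v \<in> carrier G"
    using assms Cons by (auto intro: letter_val_closed word_val_closed)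
  have "letter_val a \<otimes> (inv letter_val a \<otimes> word_val G v) = word_val G v"
    by (simp flip: m_assoc)
  then show ?thesis
    using assms Cons by (auto simp: word_val_Cons letter_val_flip simp del: word_val.simps(2))
qed (simp add: word_val_Cons del: word_val.simps(2))

lemma word_val_reduce:
  assumes "w \<in> words (carrier G)"
  shows "word_val G (reduce w) = word_val G w"
  using assms
proof (induction w)
  case (Cons a w)
  then have "a # reduce w \<in> words (carrier G)"
    using reduce_in_words [of w] by auto
  with Cons show ?case
    by (simp add: word_val_push word_val_Cons del: word_val.simps(2))
qed simp

lemma word_val_replicate:
  assumes "x \<in> carrier G"
  shows "word_val G (replicate n (x, True)) = x [^] n"
proof (induction n)
  case (Suc n)
  then show ?case using assms nat_pow_Suc2 [of x n] by simp
qed simp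

end

section \<open>Counting edges along a path in a Schreier graph\<close>

context group
begin

text \<open>A word \<open>w\<close> describes a path from \<open>u\<close> through the vertices \<open>L #> u \<otimes> v\<close>, \<open>v\<close> a prefix of \<open>w\<close>,
  of the Schreier graph of \<open>L\<close>. The signed number of times it runs through the edge
  labelled \<open>a\<close> that leaves the vertex \<open>L\<close>:\<close>

fun edge_count :: "'a set \<Rightarrow> 'a \<times> bool \<Rightarrow> 'a \<Rightarrow> ('a \<times> bool) list \<Rightarrow> int" where
  "edge_count L a u [] = 0"
| "edge_count L a u (b # w) = of_bool (b = a \<and> u \<in> L)
     - of_bool (b = flip a \<and> u \<otimes> letter_val b \<in> L) + edge_count L a (u \<otimes> letter_val b) w"

lemma edge_count_append:
  assumes "u \<in> carrier G" "v \<in> words (carrier G)" "w \<in> words (carrier G)"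
  shows "edge_count L a u (v @ w) = edge_count L a u v + edge_count L a (u \<otimes> word_val G v) w"
  using assms
proof (induction v arbitrary: u)
  case (Cons b v)
  then show ?case
    by (auto simp: word_val_Cons letter_val_closed word_val_closed m_assoc simp del: word_val.simps(2))
qed simp

text \<open>A letter followed by its \<open>flip\<close> runs along an edge and straight back, which
  contributes 0. Hence free reduction does not change the count.\<close>

lemma edge_count_push:
  assumes "u \<in> carrier G" "b # w \<in> words (carrier G)"
  shows "edge_count L a u (push b w) = edge_count L a u (b # w)"
proof (cases w)
  case (Cons c v)
  have "letter_val b \<in> carrier G" using assms by (auto intro: letter_val_closed)
  then have "u \<otimes> letter_val b \<otimes> inv letter_val b = u"
    using assms by (simp add: m_assoc)
  then show ?thesis
    using assms Cons by (auto simp: letter_val_flip)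
qed simp

lemma edge_count_reduce:
  assumes "u \<in> carrier G" "w \<in> words (carrier G)"
  shows "edge_count L a u (reduce w) = edge_count L a u w"
  using assms
proof (induction w arbitrary: u)
  case (Cons b w)
  then have *: "b # reduce w \<in> words (carrier G)"
    using reduce_in_words [of w] by auto
  have "u \<otimes> letter_val b \<in> carrier G"
    using Cons by (auto intro: letter_val_closed)
  with Cons show ?case by (simp add: edge_count_push [OF _ *])
qed simp

lemma edge_count_eq_sum:
  assumes "u \<in> carrier G" "w \<in> words (carrier G)"
  shows "edge_count L a u w = (\<Sum>i<length w.
     of_bool (w ! i = a \<and> u \<otimes> word_val G (take i w) \<in> L)
   - of_bool (w ! i = flip a \<and> u \<otimes> word_val G (take (Suc i) w) \<in> L))"
  using assms
proof (induction w arbitrary: u)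
  case (Cons b w)
  have [simp]: "letter_val b \<in> carrier G" "\<And>i. word_val G (take i w) \<in> carrier G"
    using Cons by (auto intro!: letter_val_closed word_val_closed take_in_words)
  have "u \<otimes> letter_val b \<in> carrier G" using Cons.prems by simp
  with Cons show ?case
    by (simp add: sum.lessThan_Suc_shift word_val_Cons m_assoc del: word_val.simps(2) sum.lessThan_Suc)
qed simp

lemma edge_count_eq_0:
  assumes "u \<in> carrier G" "w \<in> words (carrier G)"
    and "\<And>i. i \<le> length w \<Longrightarrow> u \<otimes> word_val G (take i w) \<notin> L"
  shows "edge_count L a u w = 0"
  unfolding edge_count_eq_sum [OF assms(1,2)] using assms(3)
  by (intro sum.neutral) auto

text \<open>Here \<open>l \<otimes> u\<close> and \<open>u\<close> name the same vertex, as the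
  vertices are the cosets \<open>L #> u\<close>.\<close>

lemma edge_count_coset:
  assumes "subgroup L G" "u \<in> carrier G" "l \<in> L" "w \<in> words (carrier G)"
  shows "edge_count L a (l \<otimes> u) w = edge_count L a u w"
proof -
  interpret L: subgroup L G by fact
  have "l \<otimes> v \<in> L \<longleftrightarrow> v \<in> L" if "v \<in> carrier G" for v
  proof
    assume "l \<otimes> v \<in> L"
    then have "inv l \<otimes> (l \<otimes> v) \<in> L" using assms by blast
    then show "v \<in> L" using that assms by (simp flip: m_assoc)
  qed (use assms in blast)
  then show ?thesis
    using assms by (simp add: edge_count_eq_sum m_assoc word_val_closed take_in_words)
qed

end

section \<open>Free groups\<close>

locale free_group_on = group F for F (structure) +
  fixes S
  assumes basis: "free_basis F S"
begin

lemma S_subset: "S \<subseteq> carrier F"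
  using basis by (simp add: free_basis_def)

lemma in_words_carrier: "w \<in> words S \<Longrightarrow> w \<in> words (carrier F)"
  using words_mono S_subset by blast

lemma val_closed [simp]: "w \<in> words S \<Longrightarrow> word_val F w \<in> carrier F"
  by (simp add: in_words_carrier word_val_closed)

lemma reduced_word_unique:
  assumes "v \<in> words S" "w \<in> words S" "reduced_word v" "reduced_word w"
    and "word_val F v = word_val F w"
  shows "v = w"
  using assms basis by (auto simp: free_basis_def bij_betw_def words_eq_lists dest: inj_onD)

definition normal_form :: "'a \<Rightarrow> ('a \<times> bool) list" where
  "normal_form g = inv_into {w \<in> words S. reduced_word w} (word_val F) g"

lemma
  assumes "g \<in> carrier F"
  shows normal_form_in_words [simp]: "normal_form g \<in> words S"
    and reduced_normal_form: "reduced_word (normal_form g)"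
    and val_normal_form [simp]: "word_val F (normal_form g) = g"
proof -
  have *: "g \<in> word_val F ` {w \<in> words S. reduced_word w}"
    using assms basis by (simp add: free_basis_def bij_betw_def words_eq_lists)
  show "normal_form g \<in> words S" "reduced_word (normal_form g)" "word_val F (normal_form g) = g"
    using inv_into_into [OF *] f_inv_into_f [OF *] by (simp_all add: normal_form_def)
qed

lemma normal_form_val:
  assumes "w \<in> words S"
  shows "normal_form (word_val F w) = reduce w"
  using assms
  by (intro reduced_word_unique)
    (simp_all add: reduced_normal_form reduce_in_words word_val_reduce in_words_carrier)

lemma length_le_if_reduced:
  assumes "v \<in> words S" "w \<in> words S" "reduced_word v" "word_val F v = word_val F w"
  shows "length v \<le> length w"
proof -
  have "v = reduce w"
    using assms normal_form_val by (metis normal_form_val reduce_in_words reduced_word_reduce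
      reduced_word_unique in_words_carrier word_val_reduce)
  then show ?thesis by (simp add: length_reduce)
qed

text \<open>The normal form makes the count a function of group elements; by \<open>flow_val\<close>
  any word over \<open>S\<close> computes it. For normal \<open>L\<close>, moving the start
  \<open>u\<close> amounts to moving the edge, so the single edge at the vertex \<open>L\<close>
  stands for all edges labelled \<open>a\<close>.\<close>

definition flow :: "'a set \<Rightarrow> 'a \<times> bool \<Rightarrow> 'a \<Rightarrow> 'a \<Rightarrow> int" where
  "flow L a u g = edge_count L a u (normal_form g)"

lemma flow_val:
  assumes "u \<in> carrier F" "w \<in> words S"
  shows "flow L a u (word_val F w) = edge_count L a u w"
  using assms by (simp add: flow_def normal_form_val edge_count_reduce in_words_carrier)

lemma flow_mult:
  assumes "u \<in> carrier F" "g \<in> carrier F" "h \<in> carrier F"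
  shows "flow L a u (g \<otimes> h) = flow L a u g + flow L a (u \<otimes> g) h"
proof -
  have "g \<otimes> h = word_val F (normal_form g @ normal_form h)"
    using assms by (simp add: word_val_append in_words_carrier)
  then have "flow L a u (g \<otimes> h) = edge_count L a u (normal_form g @ normal_form h)"
    using assms by (simp add: flow_val)
  then show ?thesis
    using assms by (simp add: edge_count_append in_words_carrier flow_def)
qed

lemma flow_one [simp]: "u \<in> carrier F \<Longrightarrow> flow L a u \<one> = 0"
  using flow_mult [of u \<one> \<one>] by simp

lemma flow_inv:
  assumes "u \<in> carrier F" "g \<in> carrier F"
  shows "flow L a u (inv g) = - flow L a (u \<otimes> inv g) g"
  using assms flow_mult [of u "inv g" g L a] by simp

lemma flow_coset:
  assumes "subgroup L F" "l \<in> L" "u \<in> carrier F" "g \<in> carrier F"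
  shows "flow L a (l \<otimes> u) g = flow L a u g"
  using assms by (simp add: flow_def edge_count_coset in_words_carrier)

text \<open>Since \<open>x\<close> lies in the normal subgroup \<open>L\<close>, the path of
  \<open>inv g\<close> runs back through the vertices that the path of \<open>g\<close> visited, and
  the two contributions cancel.\<close>

lemma flow_conj:
  assumes L: "L \<lhd> F" and "u \<in> carrier F" "g \<in> carrier F" "x \<in> L"
  shows "flow L a u (g \<otimes> x \<otimes> inv g) = flow L a (u \<otimes> g) x"
proof -
  interpret L: normal L F by fact
  have x: "x \<in> carrier F" using \<open>x \<in> L\<close> by (rule L.mem_carrier)
  have "u \<otimes> g \<otimes> x \<otimes> inv g = (u \<otimes> g) \<otimes> x \<otimes> inv (u \<otimes> g) \<otimes> u"
    using assms x by (simp add: m_assoc inv_mult_group)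
  also have "flow L a \<dots> g = flow L a u g"
    using assms x L.inv_op_closed2 [of "u \<otimes> g" x] by (intro flow_coset) (auto intro: L.subgroup_axioms)
  finally show ?thesis
    using assms x by (simp add: flow_mult flow_inv m_assoc)
qed

text \<open>The stage of the tower after \<open>L\<close>: the elements of \<open>L\<close> with trivial image in the homology
  modulo \<open>n\<close> of the Cayley graph of \<open>F / L\<close>, restricted to the edges with labels in \<open>A\<close>.\<close>

definition flow_kernel :: "'a set \<Rightarrow> 'a set \<Rightarrow> nat \<Rightarrow> 'a set" where
  "flow_kernel A L n =
     {g \<in> L. \<forall>u \<in> carrier F. \<forall>a. fst a \<in> A \<longrightarrow> int n dvd flow L a u g}"

lemma flow_kernel_subset: "flow_kernel A L n \<subseteq> L"
  by (auto simp: flow_kernel_def)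

lemma flow_kernelD:
  assumes "g \<in> flow_kernel A L n" "u \<in> carrier F" "fst a \<in> A"
  shows "int n dvd flow L a u g"
  using assms unfolding flow_kernel_def by blast

text \<open>Products and conjugates shift the starting point of a path, by \<open>flow_mult\<close>
  and \<open>flow_conj\<close>; the kernel allows for this by asking for divisibility from every
  start \<open>u\<close>.\<close>

lemma normal_flow_kernel:
  assumes "L \<lhd> F"
  shows "flow_kernel A L n \<lhd> F"
proof (rule normal_invI)
  interpret L: normal L F by fact
  show "subgroup (flow_kernel A L n) F"
  proof (rule subgroupI)
    show "flow_kernel A L n \<subseteq> carrier F"
      using flow_kernel_subset L.subset by blast
    show "flow_kernel A L n \<noteq> {}"
    proof -
      have "\<one> \<in> flow_kernel A L n" by (simp add: flow_kernel_def)
      then show ?thesis by blast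
    qed
  next
    fix g assume g: "g \<in> flow_kernel A L n"
    then have "g \<in> L" by (simp add: flow_kernel_def)
    then have "g \<in> carrier F" "inv g \<in> L" by simp_all
    then show "inv g \<in> flow_kernel A L n"
      using g by (simp add: flow_kernel_def flow_inv)
  next
    fix g h assume gh: "g \<in> flow_kernel A L n" "h \<in> flow_kernel A L n"
    then have "g \<in> L" "h \<in> L" by (simp_all add: flow_kernel_def)
    then have "g \<in> carrier F" "h \<in> carrier F" "g \<otimes> h \<in> L" by simp_all
    then show "g \<otimes> h \<in> flow_kernel A L n"
      using gh by (simp add: flow_kernel_def flow_mult)
  qed
next
  fix g x assume "g \<in> carrier F" "x \<in> flow_kernel A L n"
  then show "g \<otimes> x \<otimes> inv g \<in> flow_kernel A L n"
    using normal.inv_op_closed2 [OF assms] by (auto simp: flow_kernel_def flow_conj [OF assms])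
qed

lemma flow_right_coset:
  assumes L: "L \<lhd> F" and "u \<in> carrier F" "l \<in> L" "g \<in> carrier F"
  shows "flow L a (u \<otimes> l) g = flow L a u g"
proof -
  interpret L: normal L F by fact
  have l: "l \<in> carrier F" using \<open>l \<in> L\<close> by (rule L.mem_carrier)
  have "u \<otimes> l = (u \<otimes> l \<otimes> inv u) \<otimes> u" using assms l by (simp add: m_assoc)
  also have "flow L a \<dots> g = flow L a u g"
    using assms L.inv_op_closed2 by (intro flow_coset) (auto intro: L.subgroup_axioms)
  finally show ?thesis .
qed

text \<open>A power of \<open>g \<in> L\<close> repeats one closed path, so every round contributes
  the same flow.\<close>

lemma flow_pow:
  assumes "L \<lhd> F" "u \<in> carrier F" "g \<in> L"
  shows "flow L a u (g [^] (k::nat)) = int k * flow L a u g"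
proof (induction k)
  case (Suc k)
  interpret L: normal L F by fact
  have "g \<in> carrier F" "g [^] k \<in> L"
    using assms L.subgroup_axioms by (simp_all add: L.mem_carrier subgroup_nat_pow_closed)
  then show ?case
    using assms Suc by (simp add: flow_mult flow_right_coset algebra_simps)
qed (use assms in simp)

lemma flow_kernel_pow:
  assumes "L \<lhd> F" "g \<in> L"
  shows "g [^] n \<in> flow_kernel A L n"
  using assms by (auto simp: flow_kernel_def flow_pow intro: normal_imp_subgroup subgroup_nat_pow_closed)

text \<open>Elements of the same coset of \<open>L\<close> with the same flows modulo \<open>n\<close> agree modulo the kernel, so
  finitely many residues determine a coset of the kernel.\<close>

lemma finite_rcosets_flow_kernel:
  assumes L: "L \<lhd> F" and fin: "finite (rcosets L)" and A: "finite A" and n: "n > 0"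
  shows "finite (rcosets (flow_kernel A L n))"
proof -
  interpret L: normal L F by fact
  interpret K: normal "flow_kernel A L n" F by (rule normal_flow_kernel [OF L])
  define rep where "rep c = (SOME g. g \<in> carrier F \<and> c = L #> g)" for c
  have rep: "rep (L #> u) \<in> carrier F" "L #> u = L #> rep (L #> u)" if "u \<in> carrier F" for u
    using someI [of "\<lambda>g. g \<in> carrier F \<and> L #> u = L #> g" u] that by (simp_all add: rep_def)
  \<comment> \<open>The flow from \<open>u\<close> depends on the coset of \<open>u\<close> alone,
    so the representatives \<open>rep c\<close> suffice as starting points and finitely many
    residues remain.\<close>
  define res where "res g = restrict (\<lambda>(c, a). flow L a (rep c) g mod int n)
    ((rcosets L) \<times> A \<times> UNIV)" for g
  define f where "f g = (L #> g, res g)" for g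
  have "f ` carrier F \<subseteq> (rcosets L) \<times> PiE ((rcosets L) \<times> A \<times> UNIV) (\<lambda>_. {0..<int n})"
    using n L.subset by (auto simp: f_def res_def rcosetsI)
  moreover have "finite \<dots>"
    using fin A by (intro finite_SigmaI finite_PiE) auto
  ultimately have fin_f: "finite (f ` carrier F)" by (rule finite_subset)
  have "flow_kernel A L n #> g = flow_kernel A L n #> h"
    if g: "g \<in> carrier F" and h: "h \<in> carrier F" and eq: "f g = f h" for g h
  proof -
    have Lgh: "L #> g = L #> h" using eq by (simp add: f_def)
    then have in_L: "g \<otimes> inv h \<in> L"
      using g h by (simp add: r_coset_eq_iff L.subgroup_axioms)
    have "int n dvd flow L a u (g \<otimes> inv h)" if u: "u \<in> carrier F" and a: "fst a \<in> A" for u a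
    proof -
      obtain l where l: "l \<in> L" "u = l \<otimes> rep (L #> u)"
      proof -
        have "u \<in> L #> rep (L #> u)"
          using rcos_self [OF u L.subgroup_axioms] by (simp flip: rep(2) [OF u])
        then show thesis using that by (auto simp: r_coset_def)
      qed
      have 1: "flow L a u v = flow L a (rep (L #> u)) v" if "v \<in> carrier F" for v
        using l that rep(1) [OF u] by (subst l(2)) (rule flow_coset [OF L.subgroup_axioms])
      have "res g (L #> u, a) = res h (L #> u, a)" using eq by (simp add: f_def)
      then have 2: "flow L a u g mod int n = flow L a u h mod int n"
        using u a g h L.subset by (simp add: res_def 1 rcosetsI mem_Times_iff)
      \<comment> \<open>As \<open>g \<otimes> inv h\<close> lies in \<open>L\<close>, the path of
        \<open>inv h\<close> after that of \<open>g\<close> retraces the path of \<open>h\<close>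
        from \<open>u\<close>; so the flow of \<open>g \<otimes> inv h\<close> is the difference of
        the two flows.\<close>
      have "u \<otimes> g \<otimes> inv h = u \<otimes> (g \<otimes> inv h)" using u g h by (simp add: m_assoc)
      then have "flow L a (u \<otimes> g \<otimes> inv h) h = flow L a u h"
        using flow_right_coset [OF L u in_L h] by metis
      moreover have "flow L a u (g \<otimes> inv h) = flow L a u g - flow L a (u \<otimes> g \<otimes> inv h) h"
        using flow_mult [OF u g, of "inv h"] flow_inv [of "u \<otimes> g" h] u g h by simp
      ultimately have "flow L a u (g \<otimes> inv h) = flow L a u g - flow L a u h"
        by metis
      with 2 show ?thesis by (metis mod_eq_dvd_iff)
    qed
    with in_L have "g \<otimes> inv h \<in> flow_kernel A L n" unfolding flow_kernel_def by blast
    then show ?thesis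
      using g h by (simp add: r_coset_eq_iff K.subgroup_axioms)
  qed
  with fin_f have "finite ((#>) (flow_kernel A L n) ` carrier F)"
    by (rule finite_image_if_factors)
  then show ?thesis by (simp add: RCOSETS_def UNION_singleton_eq_range)
qed

text \<open>Raising to the power \<open>p ^ n\<close> carries \<open>L\<close> into the kernel by
  \<open>flow_kernel_pow\<close>, so every element still has some \<open>p\<close>-power in
  it.\<close>

lemma finite_p_group_flow_kernel:
  assumes "Factorial_Ring.prime p" and L: "L \<lhd> F" and fin: "finite_p_group p (F Mod L)"
    and A: "finite A"
  shows "finite_p_group p (F Mod flow_kernel A L (p ^ n))"
  unfolding normal.finite_p_group_Mod_iff [OF normal_flow_kernel [OF L] assms(1)]
proof (intro conjI ballI)
  have *: "finite (rcosets L)" "\<forall>x \<in> carrier F. \<exists>k. x [^] (p ^ k) \<in> L"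
    using fin normal.finite_p_group_Mod_iff [OF L assms(1)] by simp_all
  show "finite (rcosets (flow_kernel A L (p ^ n)))"
    using assms(1) by (intro finite_rcosets_flow_kernel L * A) (simp add: prime_gt_0_nat)
  fix x assume x: "x \<in> carrier F"
  with * obtain k where "x [^] (p ^ k) \<in> L" by blast
  then have "(x [^] (p ^ k)) [^] (p ^ n) \<in> flow_kernel A L (p ^ n)"
    by (rule flow_kernel_pow [OF L])
  then have "x [^] (p ^ (k + n)) \<in> flow_kernel A L (p ^ n)"
    using x by (simp add: nat_pow_pow power_add)
  then show "\<exists>k. x [^] (p ^ k) \<in> flow_kernel A L (p ^ n)" by blast
qed

end

section \<open>Lifting conjugacy from finite \<open>p\<close>-quotients\<close>

context free_group_on
begin

section \<open>The tower of flow kernels\<close>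

definition tower :: "'a set \<Rightarrow> nat \<Rightarrow> 'a set \<Rightarrow> nat \<Rightarrow> 'a set" where
  "tower A n K k = ((\<lambda>L. flow_kernel A L n) ^^ k) K"

lemma tower_0 [simp]: "tower A n K 0 = K"
  and tower_Suc [simp]: "tower A n K (Suc k) = flow_kernel A (tower A n K k) n"
  by (simp_all add: tower_def)

lemma tower_subset: "tower A n K k \<subseteq> K"
proof (induction k)
  case (Suc k)
  then show ?case using flow_kernel_subset unfolding tower_Suc by blast
qed simp

lemma normal_tower: "K \<lhd> F \<Longrightarrow> tower A n K k \<lhd> F"
  by (induction k) (auto intro: normal_flow_kernel)

lemma finite_p_group_tower:
  assumes "Factorial_Ring.prime p" "K \<lhd> F" "finite_p_group p (F Mod K)" "finite A"
  shows "finite_p_group p (F Mod tower A (p ^ n) K k)"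
  by (induction k) (simp_all add: assms normal_tower finite_p_group_flow_kernel)

lemma word_val_in_normal_iff:
  assumes "L \<lhd> F" "fst a \<in> S" "v \<in> words S"
  shows "word_val F (a # v @ [flip a]) \<in> L \<longleftrightarrow> word_val F v \<in> L"
proof -
  interpret L: normal L F by fact
  have a: "letter_val a \<in> carrier F" using assms S_subset by (auto intro: letter_val_closed)
  have eq: "word_val F (a # v @ [flip a]) = letter_val a \<otimes> word_val F v \<otimes> inv letter_val a"
    using assms a S_subset
    by (simp add: word_val_Cons word_val_append in_words_carrier letter_val_flip subset_iff
        m_assoc del: word_val.simps(2))
  have unconj: "word_val F v = inv letter_val a \<otimes> (letter_val a \<otimes> word_val F v \<otimes> inv letter_val a) \<otimes> letter_val a"
    using a assms(3) by (simp add: m_assoc) (simp flip: m_assoc)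
  show ?thesis
    unfolding eq
  proof
    assume "letter_val a \<otimes> word_val F v \<otimes> inv letter_val a \<in> L"
    then show "word_val F v \<in> L" by (subst unconj) (rule L.inv_op_closed1 [OF a])
  qed (rule L.inv_op_closed2 [OF a])
qed

text \<open>By induction, a short closed path visits its initial vertex only at its ends. So the flow through
  its first edge is 1 unless it comes back along this edge; then the word is a conjugate of a shorter one.\<close>

lemma short_word_notin_tower:
  assumes K: "K \<lhd> F" and A: "A \<subseteq> S" and n: "n > 1"
    and "w \<in> words A" "reduced_word w" "w \<noteq> []" "length w \<le> k"
  shows "word_val F w \<notin> tower A n K k"
  using assms(4-)
proof (induction k arbitrary: w)
  case (Suc k)
  define L where "L = tower A n K k"
  have L: "L \<lhd> F" using K by (simp add: L_def normal_tower)
  interpret L: normal L F by (rule L)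
  have wS: "v \<in> words S" if "v \<in> words A" for v using that A words_mono by blast
  obtain a v where w: "w = a # v" using Suc.prems by (cases w) auto
  have aA: "fst a \<in> A" and vA: "v \<in> words A" using Suc.prems by (simp_all add: w)
  have aS: "fst a \<in> S" using aA A by blast
  have a: "letter_val a \<in> carrier F" using aS S_subset by (auto intro: letter_val_closed)
  \<comment> \<open>Nonempty prefixes of \<open>w\<close> of length at most \<open>k\<close> are
    reduced, so by induction their values avoid \<open>L\<close>.\<close>
  have prefix: "letter_val a \<otimes> word_val F (take i v) \<notin> L" if "i < k" "i \<le> length v" for i
  proof -
    have "take (Suc i) w \<in> words A" "reduced_word (take (Suc i) w)"
      using Suc.prems take_in_words reduced_word_take by blast+
    then have "word_val F (a # take i v) \<notin> L"
      using Suc.IH [of "a # take i v"] that by (simp add: w L_def)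
    then show ?thesis by (simp only: word_val_Cons not_False_eq_True)
  qed
  show ?case
  proof
    assume "word_val F w \<in> tower A n K (Suc k)"
    then have w_ker: "word_val F w \<in> flow_kernel A L n" by (simp add: L_def)
    then have w_L: "word_val F w \<in> L" using flow_kernel_subset by blast
    have "flow L a \<one> (word_val F w) = edge_count L a \<one> w"
      using Suc.prems wS by (simp add: flow_val)
    also have "\<dots> = 1 + edge_count L a (letter_val a) v"
      using a by (simp add: w)
    also have "edge_count L a (letter_val a) v = 0"
    \<comment> \<open>If \<open>length v < k\<close>, \<open>prefix\<close> covers every vertex of
      the path. Otherwise it leaves out the endpoint, so the last letter \<open>b\<close> is treated
      apart: it could only count as the reverse of the first edge.\<close>
    proof (cases "length v < k")
      case True
      then show ?thesis
        using prefix a vA wS by (intro edge_count_eq_0) (auto simp: in_words_carrier)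
    next
      case False
      with Suc.prems have len: "length v = k" by (simp add: w)
      show ?thesis
      proof (cases v rule: rev_cases)
        case (snoc u b)
        have uA: "u \<in> words A" and b: "fst b \<in> S" using vA A by (auto simp: snoc)
        have "b \<noteq> flip a"
        proof
          assume "b = flip a"
          then have w': "w = a # u @ [flip a]" by (simp add: w snoc)
          then have "u \<noteq> []" "reduced_word u"
            using Suc.prems by (auto simp: reduced_word_Cons reduced_word_append)
          moreover have "length u \<le> k" using len by (simp add: snoc)
          ultimately have "word_val F u \<notin> L" using Suc.IH uA by (simp add: L_def)
          moreover have "word_val F u \<in> L"
            using w_L aS wS [OF uA] L by (simp add: w' word_val_in_normal_iff)
          ultimately show False by blast
        qed
        moreover have "edge_count L a (letter_val a) u = 0"
        proof (rule edge_count_eq_0)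
          fix i assume "i \<le> length u"
          then show "letter_val a \<otimes> word_val F (take i u) \<notin> L"
            using prefix [of i] len by (simp add: snoc)
        qed (use a uA wS in \<open>auto simp: in_words_carrier\<close>)
        moreover have "letter_val a \<otimes> word_val F u \<notin> L"
          using prefix [of "length u"] len by (simp add: snoc)
        ultimately show ?thesis
          using a uA b wS S_subset by (auto simp: snoc edge_count_append in_words_carrier)
      qed simp
    qed
    finally have "flow L a \<one> (word_val F w) = 1" by simp
    moreover have "int n dvd flow L a \<one> (word_val F w)"
      using w_ker aA by (intro flow_kernelD) auto
    ultimately have "int n dvd 1" by metis
    with n show False by simp
  qed
qed simp

lemma short_word_in_tower:
  assumes "K \<lhd> F" "A \<subseteq> S" "n > 1" "w \<in> words A" "length w \<le> k"
    and "word_val F w \<in> tower A n K k"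
  shows "word_val F w = \<one>"
proof -
  have w: "w \<in> words (carrier F)" using assms words_mono in_words_carrier by blast
  have "reduce w = []"
    using short_word_notin_tower [OF assms(1-3), of "reduce w" k] assms length_reduce [of w]
    by (auto simp: word_val_reduce [OF w] reduce_in_words)
  then show ?thesis using word_val_reduce [OF w] by simp
qed

text \<open>Induction strips the letters \<open>a\<close> and \<open>flip a\<close> from the ends,
  collecting them in the conjugator \<open>c\<close>, until \<open>reduced_word_cases\<close> yields
  a cyclically reduced core.\<close>

lemma exists_cyclically_reduced:
  assumes "w \<in> words S" "reduced_word w" "w \<noteq> []"
  shows "\<exists>c x. c \<in> carrier F \<and> x \<in> words S \<and> reduced_word (x @ x) \<and> x \<noteq> [] \<and>
    word_val F w = c \<otimes> word_val F x \<otimes> inv c"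
  using assms
proof (induction w rule: length_induct)
  case (1 w)
  from 1(3) show ?case
  proof (cases rule: reduced_word_cases)
    case cyclically_reduced
    with 1 show ?thesis by (intro exI [of _ \<one>] exI [of _ w]) simp
  next
    case (conjugate a v)
    then have v: "v \<in> words S" "reduced_word v" and aS: "fst a \<in> S"
      using 1 by (auto simp: reduced_word_Cons reduced_word_append)
    obtain c x where x: "c \<in> carrier F" "x \<in> words S" "reduced_word (x @ x)" "x \<noteq> []"
      "word_val F v = c \<otimes> word_val F x \<otimes> inv c"
      using 1(1) [rule_format, of v] v conjugate by auto
    have a: "letter_val a \<in> carrier F" using aS S_subset by (auto intro: letter_val_closed)
    have "word_val F w = letter_val a \<otimes> word_val F v \<otimes> inv letter_val a"
      using conjugate v a aS S_subset
      by (simp add: word_val_Cons word_val_append in_words_carrier letter_val_flip subset_iff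
          m_assoc del: word_val.simps(2))
    also have "\<dots> = (letter_val a \<otimes> c) \<otimes> word_val F x \<otimes> inv (letter_val a \<otimes> c)"
      using a x by (simp add: m_assoc inv_mult_group)
    finally show ?thesis using a x(1-4) by blast
  qed
qed

lemma flow_nat_pow:
  assumes "u \<in> carrier F" "g \<in> carrier F"
  shows "flow L a u (g [^] (m::nat)) = (\<Sum>j<m. flow L a (u \<otimes> g [^] j) g)"
  by (induction m) (simp_all add: assms flow_mult)

text \<open>Modulo \<open>L\<close>, the powers of \<open>x\<close> run through a closed path from \<open>L\<close>. By \<open>short\<close>, whenever the path
  returns to \<open>L\<close> inside of a period, the prefix \<open>c\<close> of \<open>x\<close> read so far commutes with \<open>x\<close>. It does
  not return along its first edge, as \<open>x \<otimes> c\<close> involves no cancellation.\<close>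

lemma flow_cyclically_reduced_power:
  assumes L: "L \<lhd> F" and x: "x \<in> words A" "reduced_word (x @ x)" "x \<noteq> []" and A: "A \<subseteq> S"
    and fin: "finite (rcosets L)"
    and short: "\<And>w. w \<in> words A \<Longrightarrow> length w \<le> 4 * length x \<Longrightarrow> word_val F w \<in> L \<Longrightarrow> word_val F w = \<one>"
  obtains m where "m > 0" "word_val F x [^] (m::nat) \<in> L"
    "1 \<le> flow L (hd x) \<one> (word_val F x [^] m)"
    "flow L (hd x) \<one> (word_val F x [^] m) \<le> int (length x)"
proof -
  interpret L: normal L F by fact
  interpret Q: group "F Mod L" by (rule L.factorgroup_is_group)
  define X' where "X' = word_val F x"
  \<comment> \<open>The order of \<open>X'\<close> modulo \<open>L\<close>, so that \<open>m\<close>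
    rounds of \<open>x\<close> make a closed path.\<close>
  define m where "m = group.ord (F Mod L) (L #> X')"
  define a where "a = hd x"
  have xS: "x \<in> words S" using x(1) A words_mono by blast
  have X': "X' \<in> carrier F" using xS by (simp add: X'_def)
  have LX: "L #> X' \<in> carrier (F Mod L)" using X' by (simp add: carrier_FactGroup)
  have carrier: "carrier (F Mod L) = rcosets L" by (simp add: FactGroup_def)
  have prefix: "word_val F (take i x) \<in> carrier F" for i
    using take_in_words [OF xS] by simp
  have m_pos: "m > 0"
    using Q.ord_ge_1 [OF _ LX] fin by (simp add: m_def carrier)
  have m_L: "X' [^] m \<in> L"
    using L.r_coset_pow_eq_one_iff [OF X'] Q.pow_ord_eq_1 [OF LX] by (simp add: m_def)
  \<comment> \<open>At a fixed position in the period, at most one of the \<open>m\<close> rounds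
    passes through the vertex \<open>L\<close>.\<close>
  have pow_inj: "i = j"
    if "i < m" "j < m" "X' [^] i \<otimes> c \<in> L" "X' [^] j \<otimes> c \<in> L" "c \<in> carrier F" for i j :: nat and c
  proof -
    have "(X' [^] i \<otimes> c) \<otimes> inv (X' [^] j \<otimes> c) \<in> L" using that by simp
    then have "X' [^] i \<otimes> inv (X' [^] j) \<in> L"
      using that X' by (simp add: m_assoc inv_mult_group inv_mult_cancel)
    then have "L #> X' [^] i = L #> X' [^] j"
      using X' by (simp add: r_coset_eq_iff L.subgroup_axioms)
    then have "(L #> X') [^]\<^bsub>F Mod L\<^esub> i = (L #> X') [^]\<^bsub>F Mod L\<^esub> j"
      using X' by (simp add: L.r_coset_pow)
    then show "i = j"
      using inj_onD [OF Q.ord_inj [OF LX]] that(1,2) by (auto simp: m_def)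
  qed
  have no_return: "\<not> (x ! i = flip a \<and> X' [^] j \<otimes> word_val F (take (Suc i) x) \<in> L)"
    if i: "i < length x" for i and j :: nat
  proof
    define c where "c = word_val F (take (Suc i) x)"
    have c: "c \<in> carrier F" using prefix by (simp add: c_def)
    assume return: "x ! i = flip a \<and> X' [^] j \<otimes> word_val F (take (Suc i) x) \<in> L"
    then have l: "X' [^] j \<otimes> c \<in> L" by (simp add: c_def)
    let ?l = "X' [^] j \<otimes> c"
    \<comment> \<open>The commutator of \<open>?l\<close> with \<open>X'\<close> lies in
      \<open>L\<close>; conjugation by the power of \<open>X'\<close> in \<open>?l\<close> turns it
      into the commutator of \<open>c\<close> with \<open>X'\<close>.\<close>
    have "?l \<otimes> (X' \<otimes> inv ?l \<otimes> inv X') \<in> L"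
      using l X' by (simp add: L.inv_op_closed2)
    then have "inv (X' [^] j) \<otimes> (?l \<otimes> (X' \<otimes> inv ?l \<otimes> inv X')) \<otimes> X' [^] j \<in> L"
      using X' by (intro L.inv_op_closed1) auto
    moreover have "inv X' \<otimes> X' [^] j = X' [^] j \<otimes> inv X'"
      using X' by (rule inv_mult_nat_pow_comm)
    ultimately have comm_L: "c \<otimes> X' \<otimes> inv c \<otimes> inv X' \<in> L"
      using X' c by (simp add: m_assoc inv_mult_group inv_mult_cancel)
    \<comment> \<open>A word for this commutator, of length at most \<open>4 * length x\<close>, so
      \<open>short\<close> makes it trivial in \<open>F\<close> itself.\<close>
    let ?w = "take (Suc i) x @ x @ word_inv (take (Suc i) x) @ word_inv x"
    have w_val: "word_val F ?w = c \<otimes> X' \<otimes> inv c \<otimes> inv X'"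
      using xS X' c take_in_words [OF xS]
      by (simp add: word_val_append word_val_inv in_words_carrier c_def X'_def m_assoc)
    have "word_val F ?w = \<one>"
    proof (rule short)
      show "?w \<in> words A" using x(1) by (simp add: take_in_words)
    qed (use w_val comm_L i in auto)
    then have "c \<otimes> X' = X' \<otimes> c"
      unfolding w_val using X' c by (metis inv_closed inv_solve_right l_one m_closed one_closed)
    have "x = a # tl x" using x(3) by (simp add: a_def)
    then have aS: "fst a \<in> S" and tl: "tl x \<in> words S" using xS by (metis Cons_in_words)+
    then have a: "fst a \<in> carrier F" "letter_val a \<in> carrier F"
      using S_subset letter_val_closed by blast+
    have ti: "take i x \<in> words S" using xS by (rule take_in_words)
    \<comment> \<open>Since \<open>X'\<close> begins with \<open>letter_val a\<close> and
      \<open>c\<close> ends with its inverse, \<open>c \<otimes> X'\<close> has a word two letters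
      shorter than \<open>x @ take (Suc i) x\<close>. The latter has the same value and is reduced,
      being a prefix of \<open>x @ x\<close>: a contradiction.\<close>
    have c_eq: "c = word_val F (take i x) \<otimes> inv letter_val a"
      using i return ti a prefix
      by (simp add: c_def take_Suc_conv_app_nth word_val_append in_words_carrier word_val_Cons
          letter_val_flip del: word_val.simps(2))
    have X_eq: "X' = letter_val a \<otimes> word_val F (tl x)"
      unfolding X'_def by (subst \<open>x = a # tl x\<close>) (rule word_val_Cons)
    have "word_val F (x @ take (Suc i) x) = X' \<otimes> c"
      using xS take_in_words [OF xS] by (simp add: X'_def c_def word_val_append in_words_carrier)
    also have "\<dots> = word_val F (take i x) \<otimes> word_val F (tl x)"
      unfolding \<open>c \<otimes> X' = X' \<otimes> c\<close> [symmetric] using a tl ti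
      by (simp add: c_eq X_eq m_assoc inv_mult_cancel)
    also have "\<dots> = word_val F (take i x @ tl x)"
      using ti tl by (simp add: word_val_append in_words_carrier)
    finally have eq: "word_val F (x @ take (Suc i) x) = word_val F (take i x @ tl x)" .
    have "reduced_word (take (length x + Suc i) (x @ x))" using x(2) by (rule reduced_word_take)
    then have "reduced_word (x @ take (Suc i) x)" by simp
    then have "length (x @ take (Suc i) x) \<le> length (take i x @ tl x)"
      using xS ti tl take_in_words [OF xS] by (intro length_le_if_reduced [OF _ _ _ eq]) auto
    then show False using i by simp
  qed
  let ?P = "\<lambda>i (j::nat). x ! i = a \<and> X' [^] j \<otimes> word_val F (take i x) \<in> L"
  have "flow L a (X' [^] j) X' = (\<Sum>i<length x. of_bool (?P i j))" for j :: nat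
  proof -
    have "flow L a (X' [^] j) X' = edge_count L a (X' [^] j) x"
      using flow_val [of "X' [^] j" x L a] X' xS by (simp add: X'_def)
    also have "\<dots> = (\<Sum>i<length x. of_bool (?P i j))"
      unfolding edge_count_eq_sum [OF nat_pow_closed [OF X'] in_words_carrier [OF xS]]
      using no_return by (intro sum.cong) auto
    finally show ?thesis .
  qed
  \<comment> \<open>Summed by position \<open>i\<close> first: each position counts at most once by
    \<open>pow_inj\<close>, which bounds the flow by \<open>length x\<close>, and position 0 of
    round 0 counts, which makes it positive.\<close>
  then have total: "flow L a \<one> (X' [^] m) = (\<Sum>i<length x. \<Sum>j<m. of_bool (?P i j))"
    using X' by (subst sum.swap) (simp add: flow_nat_pow)
  have "(\<Sum>j<m. of_bool (?P i j)) \<le> (1::int)" for i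
    using pow_inj prefix by (intro sum_of_bool_le_1) auto
  then have "flow L a \<one> (X' [^] m) \<le> (\<Sum>i<length x. 1)"
    unfolding total by (rule sum_mono)
  moreover have "1 \<le> flow L a \<one> (X' [^] m)"
  proof -
    have "of_bool (?P 0 0) \<le> (\<Sum>j<m. of_bool (?P 0 j) :: int)"
      using m_pos by (intro member_le_sum) auto
    also have "\<dots> \<le> flow L a \<one> (X' [^] m)"
      unfolding total using x(3)
      by (intro member_le_sum [where f = "\<lambda>i. \<Sum>j<m. of_bool (?P i j)"]) (auto intro: sum_nonneg)
    finally show ?thesis using x(3) by (simp add: a_def hd_conv_nth)
  qed
  ultimately show ?thesis
    using that [OF m_pos] m_L by (simp add: a_def X'_def)
qed

text \<open>The height \<open>k\<close> pays for two uses of \<open>short\<close>: words of length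
  \<open>4 * length x\<close> in \<open>flow_cyclically_reduced_power\<close>, and
  \<open>c x c^-1 y^-1\<close> with \<open>c\<close> a prefix of \<open>y\<close>. The bound
  \<open>n > length x\<close> keeps the flow of the power of \<open>x\<close> from vanishing modulo
  \<open>n\<close>.\<close>

lemma conjugate_lift_cyclically_reduced:
  assumes K: "K \<lhd> F" and A: "A \<subseteq> S" "finite A"
    and x: "x \<in> words A" "reduced_word (x @ x)" "x \<noteq> []" and y: "y \<in> words A"
    and n: "n > length x" and k: "4 * length x + 3 * length y \<le> k"
    and fin: "finite (rcosets (tower A n K k))"
    and g: "g \<in> carrier F"
    and conj: "g \<otimes> word_val F x \<otimes> inv g \<otimes> inv word_val F y \<in> tower A n K (Suc k)"
  shows "\<exists>h \<in> carrier F. inv g \<otimes> h \<in> tower A n K k \<and> h \<otimes> word_val F x \<otimes> inv h = word_val F y"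
proof -
  define L where "L = tower A n K k"
  define M where "M = tower A n K (Suc k)"
  define x' where "x' = word_val F x"
  define y' where "y' = word_val F y"
  have L: "L \<lhd> F" and M: "M \<lhd> F" using K by (simp_all add: L_def M_def normal_tower del: tower_Suc)
  have M_L: "M \<subseteq> L" by (simp add: L_def M_def flow_kernel_subset)
  interpret L: normal L F by (rule L)
  interpret M: normal M F by (rule M)
  have xS: "x \<in> words S" and yS: "y \<in> words S" using x y A words_mono by blast+
  have x': "x' \<in> carrier F" and y': "y' \<in> carrier F" using xS yS by (simp_all add: x'_def y'_def)
  have "length x > 0" using x(3) by simp
  then have "n > 1" using n by linarith
  have short: "word_val F w = \<one>" if "w \<in> words A" "length w \<le> k" "word_val F w \<in> L" for w
    using short_word_in_tower [OF K A(1) \<open>n > 1\<close>] that by (simp add: L_def)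
  obtain m where m: "x' [^] (m::nat) \<in> L" and
    count: "1 \<le> flow L (hd x) \<one> (x' [^] m)" "flow L (hd x) \<one> (x' [^] m) \<le> int (length x)"
  proof (rule flow_cyclically_reduced_power [OF L x A(1)])
    show "finite (rcosets L)" using fin by (simp add: L_def)
    show "word_val F w = \<one>" if "w \<in> words A" "length w \<le> 4 * length x" "word_val F w \<in> L" for w
      using short that k by simp
  qed (simp add: x'_def)
  let ?a = "hd x"
  have aA: "fst ?a \<in> A" using x(1,3) by (cases x) auto
  \<comment> \<open>The discrepancy between the \<open>m\<close>-th powers of
    \<open>g x' g^-1\<close> and \<open>y'\<close>, two elements that agree modulo
    \<open>M\<close>.\<close>
  define d where "d = (g \<otimes> x' \<otimes> inv g) [^] m \<otimes> inv (y' [^] m)"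
  have "M #> (g \<otimes> x' \<otimes> inv g) = M #> y'"
    using conj g x' y' by (simp add: r_coset_eq_iff M.subgroup_axioms del: tower_Suc flip: M_def x'_def y'_def)
  then have "(M #> (g \<otimes> x' \<otimes> inv g)) [^]\<^bsub>F Mod M\<^esub> m = (M #> y') [^]\<^bsub>F Mod M\<^esub> m" by simp
  then have dM: "d \<in> M"
    using g x' y' by (simp add: M.r_coset_pow r_coset_eq_iff M.subgroup_axioms d_def)
  then have dL: "d \<in> L" using M_L by blast
  have d: "d \<in> carrier F" using dL by (rule L.mem_carrier)
  have "d \<otimes> y' [^] m = g \<otimes> x' [^] m \<otimes> inv g"
    unfolding d_def conj_nat_pow [OF g x'] using g x' y' by (simp add: m_assoc)
  \<comment> \<open>From the start \<open>inv g\<close>, the path of \<open>g\<close> leads to the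
    identity, so \<open>flow_conj\<close> leaves exactly the flow of the power of \<open>x'\<close>
    from there.\<close>
  then have "flow L ?a (inv g) (g \<otimes> x' [^] m \<otimes> inv g)
      = flow L ?a (inv g) d + flow L ?a (inv g \<otimes> d) (y' [^] m)"
    using g d y' by (metis flow_mult inv_closed nat_pow_closed)
  also have "flow L ?a (inv g \<otimes> d) (y' [^] m) = flow L ?a (inv g) (y' [^] m)"
    using g dL y' by (intro flow_right_coset [OF L]) auto
  also have "flow L ?a (inv g) (g \<otimes> x' [^] m \<otimes> inv g) = flow L ?a \<one> (x' [^] m)"
    using flow_conj [OF L _ g m, of "inv g"] g by simp
  finally have split: "flow L ?a \<one> (x' [^] m) = flow L ?a (inv g) d + flow L ?a (inv g) (y' [^] m)" .
  have "int n dvd flow L ?a (inv g) d"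
    using dM g aA unfolding M_def L_def tower_Suc by (intro flow_kernelD) auto
  moreover have "\<not> int n dvd flow L ?a \<one> (x' [^] m)"
  proof
    assume "int n dvd flow L ?a \<one> (x' [^] m)"
    then have "int n \<le> flow L ?a \<one> (x' [^] m)" using count(1) by (intro zdvd_imp_le) auto
    with count(2) n show False by linarith
  qed
  \<comment> \<open>The flow of \<open>d\<close> vanishes modulo \<open>n\<close>, that of the power
    of \<open>x'\<close> does not. So the path of the power of \<open>y'\<close> uses the edge, and
    in some round \<open>j\<close> it meets the vertex \<open>L\<close> after a prefix of
    \<open>y\<close>.\<close>
  ultimately have "flow L ?a (inv g) (y' [^] m) \<noteq> 0" unfolding split by auto
  then have "(\<Sum>j<m. flow L ?a (inv g \<otimes> y' [^] j) y') \<noteq> 0"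
    using g y' by (simp add: flow_nat_pow)
  then obtain j :: nat where "flow L ?a (inv g \<otimes> y' [^] j) y' \<noteq> 0"
    by (rule sum.not_neutral_contains_not_neutral)
  then have "edge_count L ?a (inv g \<otimes> y' [^] j) y \<noteq> 0"
    using flow_val [of "inv g \<otimes> y' [^] j" y L ?a] g y' yS by (simp add: y'_def)
  then obtain i where i: "inv g \<otimes> y' [^] j \<otimes> word_val F (take i y) \<in> L" "i \<le> length y"
    using edge_count_eq_0 [of "inv g \<otimes> y' [^] j" y L ?a] g y' yS by (auto simp: in_words_carrier)
  define c where "c = word_val F (take i y)"
  \<comment> \<open>The prefix \<open>c\<close> agrees with \<open>g\<close> modulo \<open>L\<close>
    only up to a power of \<open>y'\<close>; \<open>h\<close> restores this power, which commutes
    with \<open>y'\<close>.\<close>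
  define h where "h = y' [^] j \<otimes> c"
  have c: "c \<in> carrier F" using take_in_words [OF yS] by (simp add: c_def)
  have h: "h \<in> carrier F" using c y' by (simp add: h_def)
  have gh: "inv g \<otimes> h \<in> L" using i(1) g c y' by (simp add: h_def c_def m_assoc)
  have "g \<otimes> x' \<otimes> inv g \<otimes> inv y' \<in> L" using conj M_L by (auto simp: x'_def y'_def M_def)
  moreover have "h \<otimes> x' \<otimes> inv h \<otimes> inv (g \<otimes> x' \<otimes> inv g) \<in> L"
  proof -
    have "(inv g \<otimes> h) \<otimes> (x' \<otimes> inv (inv g \<otimes> h) \<otimes> inv x') \<in> L"
      using gh x' by (simp add: L.inv_op_closed2)
    then have "g \<otimes> ((inv g \<otimes> h) \<otimes> (x' \<otimes> inv (inv g \<otimes> h) \<otimes> inv x')) \<otimes> inv g \<in> L"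
      using g by (rule L.inv_op_closed2 [rotated])
    then show ?thesis using g h x' by (simp add: m_assoc inv_mult_group inv_mult_cancel)
  qed
  ultimately have "h \<otimes> x' \<otimes> inv h \<otimes> inv (g \<otimes> x' \<otimes> inv g) \<otimes> (g \<otimes> x' \<otimes> inv g \<otimes> inv y') \<in> L"
    by (rule L.m_closed [rotated])
  then have "h \<otimes> x' \<otimes> inv h \<otimes> inv y' \<in> L"
    using g h x' y' by (simp add: m_assoc inv_mult_group inv_mult_cancel)
  \<comment> \<open>Conjugating the power of \<open>y'\<close> away leaves only \<open>c\<close>, so
    the relation is the value of a short word and holds in \<open>F\<close>.\<close>
  then have "inv (y' [^] j) \<otimes> (h \<otimes> x' \<otimes> inv h \<otimes> inv y') \<otimes> y' [^] j \<in> L"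
    using y' by (intro L.inv_op_closed1) auto
  then have c_L: "c \<otimes> x' \<otimes> inv c \<otimes> inv y' \<in> L"
    using y' x' c by (simp add: h_def m_assoc inv_mult_group inv_mult_cancel inv_mult_nat_pow_comm)
  let ?w = "take i y @ x @ word_inv (take i y) @ word_inv y"
  have w_val: "word_val F ?w = c \<otimes> x' \<otimes> inv c \<otimes> inv y'"
    using xS yS x' y' c take_in_words [OF yS]
    by (simp add: word_val_append word_val_inv in_words_carrier c_def x'_def y'_def m_assoc)
  have "word_val F ?w = \<one>"
  proof (rule short)
    show "?w \<in> words A" using x(1) y by (simp add: take_in_words)
  qed (use w_val c_L i(2) k in auto)
  then have c_conj: "c \<otimes> x' \<otimes> inv c = y'"
    unfolding w_val using x' y' c by (metis inv_closed inv_solve_right l_one m_closed one_closed)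
  have "h \<otimes> x' \<otimes> inv h = y' [^] j \<otimes> (c \<otimes> x' \<otimes> inv c) \<otimes> inv (y' [^] j)"
    using x' y' c by (simp add: h_def m_assoc inv_mult_group)
  also have "\<dots> = y'"
  proof -
    have "y' [^] j \<otimes> y' = y' \<otimes> y' [^] j" using nat_pow_Suc2 [OF y', of j] by simp
    then show ?thesis using y' unfolding c_conj by (simp add: m_assoc)
  qed
  finally show ?thesis using h gh by (auto simp: x'_def y'_def L_def)
qed

text \<open>Applied with \<open>g\<close> running through \<open>K\<close>, this says that every \<open>K\<close>-conjugacy class is closed in
  the pro-\<open>p\<close> topology of \<open>F\<close>.\<close>

lemma conjugate_lift:
  assumes p: "Factorial_Ring.prime p" and K: "K \<lhd> F" and fin: "finite_p_group p (F Mod K)"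
    and x: "x \<in> carrier F" and y: "y \<in> carrier F"
  obtains L where "L \<lhd> F" "L \<subseteq> K" "finite_p_group p (F Mod L)"
    "\<And>g. g \<in> carrier F \<Longrightarrow> g \<otimes> x \<otimes> inv g \<otimes> inv y \<in> L \<Longrightarrow>
       \<exists>h \<in> carrier F. inv g \<otimes> h \<in> K \<and> h \<otimes> x \<otimes> inv h = y"
proof (cases "x = \<one>")
  case True
  \<comment> \<open>For trivial \<open>x\<close>, the element \<open>g x g^-1 y^-1\<close> is
    \<open>inv y\<close>; the tower only has to be high enough to tell the word \<open>w\<close> of
    \<open>inv y\<close> from the identity.\<close>
  define w where "w = word_inv (normal_form y)"
  define A where "A = fst ` set w"
  have wS: "w \<in> words S" and w_val: "word_val F w = inv y"
    using y by (simp_all add: w_def word_val_inv in_words_carrier)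
  have A: "A \<subseteq> S" "finite A" "w \<in> words A" using wS by (simp_all add: A_def words_def)
  show ?thesis
  proof (rule that [OF normal_tower [OF K] tower_subset finite_p_group_tower [OF p K fin A(2)]])
    fix g assume g: "g \<in> carrier F"
      and "g \<otimes> x \<otimes> inv g \<otimes> inv y \<in> tower A (p ^ 1) K (length w)"
    then have "word_val F w \<in> tower A (p ^ 1) K (length w)" using y by (simp add: True w_val)
    then have "word_val F w = \<one>"
      by (intro short_word_in_tower [OF K A(1) _ A(3)]) (use prime_gt_1_nat [OF p] in auto)
    then have "y = \<one>" using y by (simp add: w_val)
    then show "\<exists>h \<in> carrier F. inv g \<otimes> h \<in> K \<and> h \<otimes> x \<otimes> inv h = y"
      using g True normal.axioms(1) [OF K] subgroup.one_closed by (intro bexI [of _ g]) auto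
  qed
next
  case False
  interpret K: normal K F by (rule K)
  have "normal_form x \<noteq> []" using False x val_normal_form by fastforce
  \<comment> \<open>Pass to the cyclically reduced core of \<open>x\<close>; its conjugator
    \<open>c\<close> turns \<open>g\<close> into \<open>g \<otimes> c\<close> and the resulting
    \<open>h\<close> into \<open>h \<otimes> inv c\<close>.\<close>
  then obtain c v where c: "c \<in> carrier F" and v: "v \<in> words S" "reduced_word (v @ v)" "v \<noteq> []"
    and x_eq: "x = c \<otimes> word_val F v \<otimes> inv c"
    using exists_cyclically_reduced [OF normal_form_in_words [OF x] reduced_normal_form [OF x]]
    unfolding val_normal_form [OF x] by blast
  define w where "w = normal_form y"
  define A where "A = fst ` set v \<union> fst ` set w"
  define k where "k = 4 * length v + 3 * length w"
  have w: "w \<in> words S" "word_val F w = y" using y by (simp_all add: w_def)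
  have A: "A \<subseteq> S" "finite A" "v \<in> words A" "w \<in> words A"
    using v w by (auto simp: A_def words_def)
  have v': "word_val F v \<in> carrier F" using v by simp
  \<comment> \<open>The modulus is chosen as a power of \<open>p\<close> that exceeds
    \<open>length v\<close>.\<close>
  let ?T = "tower A (p ^ length v) K"
  show ?thesis
  proof (rule that [OF normal_tower [OF K] tower_subset finite_p_group_tower [OF p K fin A(2)]])
    fix g assume g: "g \<in> carrier F" and "g \<otimes> x \<otimes> inv g \<otimes> inv y \<in> ?T (Suc k)"
    then have *: "(g \<otimes> c) \<otimes> word_val F v \<otimes> inv (g \<otimes> c) \<otimes> inv word_val F w \<in> ?T (Suc k)"
      using c v' y by (simp add: x_eq w(2) m_assoc inv_mult_group)
    have "finite (rcosets ?T k)"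
      using finite_p_group_tower [OF p K fin A(2)] normal.finite_p_group_Mod_iff [OF normal_tower [OF K] p]
      by blast
    then obtain h where h: "h \<in> carrier F" "inv (g \<otimes> c) \<otimes> h \<in> ?T k"
      "h \<otimes> word_val F v \<otimes> inv h = word_val F w"
      using conjugate_lift_cyclically_reduced [OF K A(1,2) A(3) v(2,3) A(4) _ _ _ _ *] g c
        power_gt_expt [of p "length v"] prime_gt_1_nat [OF p]
      by (auto simp: k_def)
    have "inv (g \<otimes> c) \<otimes> h \<in> K" using h(2) tower_subset by blast
    then have "c \<otimes> (inv (g \<otimes> c) \<otimes> h) \<otimes> inv c \<in> K" using c by (rule K.inv_op_closed2 [rotated])
    then have "inv g \<otimes> (h \<otimes> inv c) \<in> K"
      using g c h(1) by (simp add: m_assoc inv_mult_group inv_mult_cancel)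
    moreover have "(h \<otimes> inv c) \<otimes> x \<otimes> inv (h \<otimes> inv c) = y"
      using c h(1,3) v' w(2) by (simp add: x_eq m_assoc inv_mult_group inv_mult_cancel)
    ultimately show "\<exists>h \<in> carrier F. inv g \<otimes> h \<in> K \<and> h \<otimes> x \<otimes> inv h = y"
      using c h(1) by blast
  qed
qed

end

section \<open>Elements with small centralizer\<close>

context free_group_on
begin

lemma commute_word_val:
  assumes "z \<in> carrier F" "w \<in> words (carrier F)" "\<And>s. s \<in> fst ` set w \<Longrightarrow> z \<otimes> s = s \<otimes> z"
  shows "z \<otimes> word_val F w = word_val F w \<otimes> z"
  using assms
proof (induction w)
  case (Cons a w)
  have a: "fst a \<in> carrier F" "letter_val a \<in> carrier F" and w: "word_val F w \<in> carrier F"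
    using Cons.prems by (auto intro: letter_val_closed word_val_closed)
  have "z \<otimes> fst a = fst a \<otimes> z" using Cons.prems by simp
  then have "z \<otimes> letter_val a = letter_val a \<otimes> z"
    using a Cons.prems(1) by (simp add: letter_val_def)
      (metis inv_closed inv_solve_left inv_solve_right m_assoc m_closed)
  with Cons a w show ?case
    by (simp add: word_val_Cons del: word_val.simps(2)) (metis m_assoc)
qed simp

text \<open>If no two generators differ, a generator commutes with all generators, hence by
  \<open>commute_word_val\<close> with all of \<open>F\<close>; then every element commutes with the
  generators, hence with all of \<open>F\<close>.\<close>

lemma exists_two_generators:
  assumes "\<not> comm_group F"
  obtains s t where "s \<in> S" "t \<in> S" "s \<noteq> t"
proof (rule ccontr)
  assume "\<not> thesis"
  with that have eq: "s = t" if "s \<in> S" "t \<in> S" for s t using \<open>s \<in> S\<close> \<open>t \<in> S\<close> by blast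
  have "z \<otimes> h = h \<otimes> z" if z: "z \<in> carrier F" "\<And>s. s \<in> S \<Longrightarrow> z \<otimes> s = s \<otimes> z" and h: "h \<in> carrier F" for z h
  proof -
    have "fst ` set (normal_form h) \<subseteq> S" using normal_form_in_words [OF h] by (simp add: words_def)
    then have "z \<otimes> word_val F (normal_form h) = word_val F (normal_form h) \<otimes> z"
      using z h by (intro commute_word_val) (auto simp: in_words_carrier)
    then show ?thesis using h by simp
  qed
  moreover from this have "z \<otimes> h = h \<otimes> z" if "z \<in> S" "h \<in> carrier F" for z h
    using that eq S_subset by blast
  ultimately have "comm_group F"
    using S_subset by (intro group_comm_groupI) (metis subset_iff)
  with assms show False by contradiction
qed

text \<open>Positive letters never run against the edge, so no terms cancel and a nonzero flow means
  an actual passage.\<close>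

lemma flow_positive_word_neq_0_iff:
  assumes u: "u \<in> carrier F" and w: "w \<in> words S" and pos: "\<forall>b \<in> set w. snd b" and a: "snd a"
  shows "flow L a u (word_val F w) \<noteq> 0 \<longleftrightarrow>
    (\<exists>i < length w. w ! i = a \<and> u \<otimes> word_val F (take i w) \<in> L)"
proof -
  have "flow L a u (word_val F w) = (\<Sum>i<length w. of_bool (w ! i = a \<and> u \<otimes> word_val F (take i w) \<in> L))"
    unfolding flow_val [OF u w] edge_count_eq_sum [OF u in_words_carrier [OF w]]
  proof (rule sum.cong)
    fix i assume "i \<in> {..<length w}"
    then have "snd (w ! i)" using pos by simp
    then have "w ! i \<noteq> flip a" using a by (cases a) auto
    then show "of_bool (w ! i = a \<and> u \<otimes> word_val F (take i w) \<in> L)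
      - of_bool (w ! i = flip a \<and> u \<otimes> word_val F (take (Suc i) w) \<in> L)
      = (of_bool (w ! i = a \<and> u \<otimes> word_val F (take i w) \<in> L) :: int)" by simp
  qed simp
  then have "flow L a u (word_val F w) = 0 \<longleftrightarrow>
      (\<forall>i \<in> {..<length w}. of_bool (w ! i = a \<and> u \<otimes> word_val F (take i w) \<in> L) = (0 :: int))"
    by (simp only: sum_nonneg_eq_0_iff [OF finite_lessThan zero_less_eq_of_bool])
  then show ?thesis by auto
qed

section \<open>Exponent sums, as flows in the one-vertex graph\<close>

lemma normal_carrier: "carrier F \<lhd> F"
  by (simp add: normal_inv_iff subgroup_self)

lemma flow_carrier_mult:
  assumes "g \<in> carrier F" "h \<in> carrier F"
  shows "flow (carrier F) a \<one> (g \<otimes> h) = flow (carrier F) a \<one> g + flow (carrier F) a \<one> h"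
  using flow_mult [OF one_closed assms, of "carrier F" a]
    flow_right_coset [OF normal_carrier one_closed assms, of a] by simp

lemma flow_carrier_inv:
  assumes "g \<in> carrier F"
  shows "flow (carrier F) a \<one> (inv g) = - flow (carrier F) a \<one> g"
  using flow_inv [OF one_closed assms, of "carrier F" a]
    flow_right_coset [OF normal_carrier one_closed inv_closed [OF assms] assms, of a] assms by simp

lemma flow_carrier_power:
  assumes s: "s \<in> S"
  shows "flow (carrier F) a \<one> (s [^] (n::nat)) = int n * (of_bool (a = (s, True)) - of_bool (a = (s, False)))"
proof -
  have sF: "s \<in> carrier F" using s S_subset by blast
  have "flow (carrier F) a \<one> s = of_bool (a = (s, True)) - of_bool (a = (s, False))"
    using flow_val [of \<one> "[(s, True)]" "carrier F" a] s sF
    by (cases a) (auto simp: letter_val_def)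
  then show ?thesis using sF by (simp add: flow_pow normal_carrier)
qed

text \<open>Take \<open>x = s^n t^n\<close> with \<open>n\<close> the order of \<open>F / N\<close>.
  If \<open>g\<close> commutes with \<open>x\<close>, the paths of \<open>x\<close> from
  \<open>g\<close> and from the identity have equal flows, so both use the \<open>s\<close>-edge and
  the \<open>t\<close>-edge at the vertex \<open>L\<close>. This puts \<open>g s^i\<close> and
  \<open>g s^n t^j\<close> in \<open>L\<close> with \<open>i < n\<close>, and comparing exponent
  sums of \<open>s\<close> modulo \<open>n\<close> forces \<open>i = 0\<close>.\<close>

lemma exists_small_centralizer:
  assumes nonab: "\<not> comm_group F" and N: "N \<lhd> F" and fin: "finite (rcosets N)"
  obtains x where "x \<in> N" "\<And>g. g \<in> carrier F \<Longrightarrow> g \<otimes> x = x \<otimes> g \<Longrightarrow> g \<in> N"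
proof -
  interpret N: normal N F by (rule N)
  interpret Q: group "F Mod N" by (rule N.factorgroup_is_group)
  have carrier: "carrier (F Mod N) = rcosets N" by (simp add: FactGroup_def)
  obtain s t where st: "s \<in> S" "t \<in> S" "s \<noteq> t" using exists_two_generators [OF nonab] .
  then have sF: "s \<in> carrier F" and tF: "t \<in> carrier F" using S_subset by blast+
  define n where "n = order (F Mod N)"
  have n: "n > 0" using fin by (simp add: n_def Q.order_gt_0_iff_finite carrier)
  have pow_N: "x [^] n \<in> N" if "x \<in> carrier F" for x
  proof -
    have "N #> x \<in> carrier (F Mod N)" using that by (simp add: carrier_FactGroup)
    then show ?thesis
      using N.r_coset_pow_eq_one_iff [OF that, of n] Q.pow_order_eq_1 unfolding n_def by blast
  qed
  \<comment> \<open>The elements whose exponent sums in \<open>s\<close> and \<open>t\<close> are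
    divisible by \<open>n\<close>.\<close>
  define E where "E = flow_kernel {s, t} (carrier F) n"
  have E: "E \<lhd> F" using normal_flow_kernel [OF normal_carrier] by (simp add: E_def)
  interpret E: normal E F by (rule E)
  define L where "L = N \<inter> E"
  have L: "L \<lhd> F"
    using N.inv_op_closed2 E.inv_op_closed2 N.subgroup_axioms E.subgroup_axioms
    by (intro normal_invI) (auto simp: L_def subgroups_Inter_pair)
  interpret L: normal L F by (rule L)
  have pow_L: "x [^] n \<in> L" if "x \<in> carrier F" for x
    using pow_N [OF that] flow_kernel_pow [OF normal_carrier that] by (simp add: L_def E_def)
  define w where "w = replicate n (s, True) @ replicate n (t, True)"
  define x where "x = s [^] n \<otimes> t [^] n"
  have w: "w \<in> words S" "\<forall>b \<in> set w. snd b" using st by (auto simp: w_def words_def)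
  have repl: "replicate i (s, True) \<in> words S" "replicate i (t, True) \<in> words S" for i
    using st by (auto simp: words_def)
  have x: "word_val F w = x"
    using sF tF repl by (simp add: w_def x_def word_val_append in_words_carrier word_val_replicate)
  have xL: "x \<in> L" using pow_L sF tF by (simp add: x_def)
  have take_s: "word_val F (take i w) = s [^] i" if "i < n" for i
    using that sF by (simp add: w_def word_val_replicate min_def)
  have take_t: "word_val F (take (n + i) w) = s [^] n \<otimes> t [^] i" if "i < n" for i
    using that sF tF repl
    by (simp add: w_def word_val_append in_words_carrier word_val_replicate min_def)
  have "g \<in> N" if g: "g \<in> carrier F" and comm: "g \<otimes> x = x \<otimes> g" for g
  proof -
    have xF: "x \<in> carrier F" using sF tF by (simp add: x_def)
    have inv: "flow L a g x = flow L a \<one> x" for a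
    proof -
      have "g \<otimes> x \<otimes> inv g = x" using g xF by (simp add: comm m_assoc)
      then show ?thesis using flow_conj [OF L one_closed g xL, of a] g by simp
    qed
    have "flow L (s, True) g x \<noteq> 0"
    proof -
      have "0 < length w" "w ! 0 = (s, True)" using n by (simp_all add: w_def nth_append)
      moreover have "\<one> \<otimes> word_val F (take 0 w) \<in> L" by simp
      ultimately show ?thesis
        unfolding inv using flow_positive_word_neq_0_iff [OF one_closed w, of "(s, True)" L]
        by (auto simp: x)
    qed
    then obtain i where i: "i < length w" "w ! i = (s, True)" "g \<otimes> word_val F (take i w) \<in> L"
      using flow_positive_word_neq_0_iff [OF g w, of "(s, True)" L] by (auto simp: x)
    then have "i < n" using st(3) by (auto simp: w_def nth_append split: if_splits)
    then have gs: "g \<otimes> s [^] i \<in> L" using i by (simp add: take_s)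
    have "flow L (t, True) g x \<noteq> 0"
    proof -
      have "n < length w" "w ! n = (t, True)" using n by (simp_all add: w_def nth_append)
      \<comment> \<open>After \<open>s^n\<close> the path from the identity is back at
        \<open>L\<close>, where it takes the \<open>t\<close>-edge.\<close>
      moreover have "\<one> \<otimes> word_val F (take n w) \<in> L" using take_t [of 0] n pow_L [OF sF] sF by simp
      ultimately show ?thesis
        unfolding inv using flow_positive_word_neq_0_iff [OF one_closed w, of "(t, True)" L]
        by (auto simp: x)
    qed
    then obtain k where k: "k < length w" "w ! k = (t, True)" "g \<otimes> word_val F (take k w) \<in> L"
      using flow_positive_word_neq_0_iff [OF g w, of "(t, True)" L] by (auto simp: x)
    then have "\<not> k < n" using st(3) by (auto simp: w_def nth_append split: if_splits)
    define j where "j = k - n"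
    have j: "j < n" "k = n + j" using \<open>\<not> k < n\<close> k(1) by (auto simp: w_def j_def)
    then have "g \<otimes> s [^] n \<otimes> t [^] j \<in> L" using k(3) take_t [OF j(1)] g sF tF by (simp add: m_assoc)
    then have "inv (g \<otimes> s [^] i) \<otimes> (g \<otimes> s [^] n \<otimes> t [^] j) \<in> E"
      using gs by (simp add: L_def)
    then have "inv (s [^] i) \<otimes> (s [^] n \<otimes> t [^] j) \<in> E"
      using g sF tF by (simp add: m_assoc inv_mult_group inv_mult_cancel)
    then have "int n dvd flow (carrier F) (s, True) \<one> (inv (s [^] i) \<otimes> (s [^] n \<otimes> t [^] j))"
      unfolding E_def by (rule flow_kernelD) simp_all
    also have "\<dots> = int n - int i"
      using sF tF st flow_carrier_power [of s "(s, True)"] flow_carrier_power [of t "(s, True)"]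
      by (simp add: flow_carrier_mult flow_carrier_inv)
    finally have "int n dvd int n - int i" .
    then have "n dvd i" by (metis dvd_diff_right_iff dvd_refl int_dvd_int_iff)
    with \<open>i < n\<close> have "i = 0" by (metis dvd_imp_le gr0I leD)
    with gs g show "g \<in> N" by (simp add: L_def)
  qed
  moreover have "x \<in> N" using xL by (simp add: L_def)
  ultimately show ?thesis using that by blast
qed

end

section \<open>Subdirect products of finite index\<close>

lemma same_fibres_bij_betw:
  assumes "\<And>x y. x \<in> A \<Longrightarrow> y \<in> A \<Longrightarrow> f x = f y \<longleftrightarrow> g x = g y"
  shows "bij_betw (\<lambda>v. g (inv_into A f v)) (f ` A) (g ` A)"
proof -
  have "g (inv_into A f (f x)) = g x" if "x \<in> A" for x
    using assms [of "inv_into A f (f x)" x] that by (simp add: inv_into_into f_inv_into_f)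
  then show ?thesis
    using assms by (force simp: bij_betw_def inj_on_def image_image)
qed

text \<open>Two elements lie in the same coset of \<open>V\<close> exactly when their images lie in
  the same coset of \<open>U\<close>, and \<open>h\<close> reaches every coset of
  \<open>U\<close>.\<close>

lemma (in group_hom) bij_betw_rcosets_vimage:
  assumes U: "subgroup U H" and surj: "\<And>y. y \<in> carrier H \<Longrightarrow> \<exists>x \<in> carrier G. h x \<in> U #>\<^bsub>H\<^esub> y"
    and V: "V = {x \<in> carrier G. h x \<in> U}"
  shows "\<exists>f. bij_betw f (rcosets V) (rcosets\<^bsub>H\<^esub> U)"
proof -
  have sub: "subgroup V G"
    unfolding V using subgroup.one_closed [OF U] subgroup.m_closed [OF U] subgroup.m_inv_closed [OF U]
    by (intro G.subgroupI) auto
  have "V #> x = V #> y \<longleftrightarrow> U #>\<^bsub>H\<^esub> h x = U #>\<^bsub>H\<^esub> h y" if "x \<in> carrier G" "y \<in> carrier G" for x y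
    unfolding G.r_coset_eq_iff [OF sub that] H.r_coset_eq_iff [OF U hom_closed [OF that(1)] hom_closed [OF that(2)]]
    using that by (simp add: V)
  then have "\<exists>f. bij_betw f ((\<lambda>x. V #> x) ` carrier G) ((\<lambda>x. U #>\<^bsub>H\<^esub> h x) ` carrier G)"
    using same_fibres_bij_betw [of "carrier G" "\<lambda>x. V #> x" "\<lambda>x. U #>\<^bsub>H\<^esub> h x"] by blast
  moreover have "(\<lambda>x. V #> x) ` carrier G = rcosets V" by (auto simp: RCOSETS_def)
  moreover have "(\<lambda>x. U #>\<^bsub>H\<^esub> h x) ` carrier G = rcosets\<^bsub>H\<^esub> U"
  proof
    show "rcosets\<^bsub>H\<^esub> U \<subseteq> (\<lambda>x. U #>\<^bsub>H\<^esub> h x) ` carrier G"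
    proof
      fix c assume "c \<in> rcosets\<^bsub>H\<^esub> U"
      then obtain y where y: "y \<in> carrier H" "c = U #>\<^bsub>H\<^esub> y" by (auto simp: RCOSETS_def)
      then obtain x where x: "x \<in> carrier G" "h x \<in> U #>\<^bsub>H\<^esub> y" using surj by blast
      then have "c = U #>\<^bsub>H\<^esub> h x" using y H.repr_independence U by blast
      with x show "c \<in> (\<lambda>x. U #>\<^bsub>H\<^esub> h x) ` carrier G" by blast
    qed
    show "(\<lambda>x. U #>\<^bsub>H\<^esub> h x) ` carrier G \<subseteq> rcosets\<^bsub>H\<^esub> U"
      using H.rcosetsI [OF subgroup.subset [OF U]] by auto
  qed
  ultimately show ?thesis by simp
qed

locale subdirect_subgroup = F1: group F1 + F2: group F2
  for F1 :: "('a, 'm) monoid_scheme" and F2 :: "('b, 'n) monoid_scheme" +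
  fixes G :: "('a \<times> 'b) set"
  assumes subdirect: "subdirect_product F1 F2 G"
begin

sublocale P: group "F1 \<times>\<times> F2"
  by (rule DirProd_group [OF F1.is_group F2.is_group])

definition N1 :: "'a set" where "N1 = {a \<in> carrier F1. (a, \<one>\<^bsub>F2\<^esub>) \<in> G}"
definition N2 :: "'b set" where "N2 = {b \<in> carrier F2. (\<one>\<^bsub>F1\<^esub>, b) \<in> G}"

lemma meet_fst_factor_eq: "meet_fst_factor F1 F2 G = N1"
  by (force simp: meet_fst_factor_def N1_def)

lemma subgroup_G: "subgroup G (F1 \<times>\<times> F2)"
  using subdirect by (simp add: subdirect_product_def)

sublocale G: group "(F1 \<times>\<times> F2)\<lparr>carrier := G\<rparr>"
  by (rule P.subgroup_imp_group [OF subgroup_G])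

lemma G_closed: "(a, b) \<in> G \<Longrightarrow> a \<in> carrier F1" "(a, b) \<in> G \<Longrightarrow> b \<in> carrier F2"
  using subgroup.subset [OF subgroup_G] by auto

lemma G_mult: "(a, b) \<in> G \<Longrightarrow> (c, d) \<in> G \<Longrightarrow> (a \<otimes>\<^bsub>F1\<^esub> c, b \<otimes>\<^bsub>F2\<^esub> d) \<in> G"
  using subgroup.m_closed [OF subgroup_G] by (metis mult_DirProd)

lemma G_inv: "(a, b) \<in> G \<Longrightarrow> (inv\<^bsub>F1\<^esub> a, inv\<^bsub>F2\<^esub> b) \<in> G"
  using subgroup.m_inv_closed [OF subgroup_G, of "(a, b)"] G_closed
  by (simp add: inv_DirProd [OF F1.is_group F2.is_group])

lemma G_conj:
  assumes "(a, b) \<in> G" "(x, y) \<in> G"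
  shows "(a \<otimes>\<^bsub>F1\<^esub> x \<otimes>\<^bsub>F1\<^esub> inv\<^bsub>F1\<^esub> a, b \<otimes>\<^bsub>F2\<^esub> y \<otimes>\<^bsub>F2\<^esub> inv\<^bsub>F2\<^esub> b) \<in> G"
    "(a, b) \<otimes>\<^bsub>(F1 \<times>\<times> F2)\<lparr>carrier := G\<rparr>\<^esub> (x, y) \<otimes>\<^bsub>(F1 \<times>\<times> F2)\<lparr>carrier := G\<rparr>\<^esub>
       inv\<^bsub>(F1 \<times>\<times> F2)\<lparr>carrier := G\<rparr>\<^esub> (a, b) =
     (a \<otimes>\<^bsub>F1\<^esub> x \<otimes>\<^bsub>F1\<^esub> inv\<^bsub>F1\<^esub> a, b \<otimes>\<^bsub>F2\<^esub> y \<otimes>\<^bsub>F2\<^esub> inv\<^bsub>F2\<^esub> b)"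
  using assms G_mult G_inv P.m_inv_consistent [OF subgroup_G assms(1)] G_closed
  by (simp_all add: inv_DirProd [OF F1.is_group F2.is_group])

lemma obtain_snd:
  assumes "a \<in> carrier F1"
  obtains b where "b \<in> carrier F2" "(a, b) \<in> G"
  using assms subdirect G_closed by (force simp: subdirect_product_def)

lemma obtain_fst:
  assumes "b \<in> carrier F2"
  obtains a where "a \<in> carrier F1" "(a, b) \<in> G"
  using assms subdirect G_closed by (force simp: subdirect_product_def)

lemma one_G: "(\<one>\<^bsub>F1\<^esub>, \<one>\<^bsub>F2\<^esub>) \<in> G"
  using subgroup.one_closed [OF subgroup_G] by simp

lemma N1_iff: "a \<in> N1 \<longleftrightarrow> (a, \<one>\<^bsub>F2\<^esub>) \<in> G"
  and N2_iff: "b \<in> N2 \<longleftrightarrow> (\<one>\<^bsub>F1\<^esub>, b) \<in> G"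
  using G_closed by (auto simp: N1_def N2_def)

lemma N1_times_N2:
  assumes "a \<in> N1" "b \<in> N2"
  shows "(a, b) \<in> G"
  using assms G_mult [of a "\<one>\<^bsub>F2\<^esub>" "\<one>\<^bsub>F1\<^esub>" b] by (simp add: N1_def N2_def)

lemma normal_N1: "N1 \<lhd> F1"
proof (rule F1.normal_invI)
  show "subgroup N1 F1"
  proof (rule F1.subgroupI)
    show "N1 \<noteq> {}" using one_G by (auto simp: N1_def)
    show "inv\<^bsub>F1\<^esub> a \<in> N1" if "a \<in> N1" for a using that G_inv by (fastforce simp: N1_def)
    show "a \<otimes>\<^bsub>F1\<^esub> c \<in> N1" if "a \<in> N1" "c \<in> N1" for a c using that G_mult by (fastforce simp: N1_def)
  qed (auto simp: N1_def)
  fix a n assume a: "a \<in> carrier F1" and n: "n \<in> N1"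
  obtain b where "b \<in> carrier F2" "(a, b) \<in> G" using a by (rule obtain_snd)
  with n show "a \<otimes>\<^bsub>F1\<^esub> n \<otimes>\<^bsub>F1\<^esub> inv\<^bsub>F1\<^esub> a \<in> N1"
    using a G_conj(1) [of a b n "\<one>\<^bsub>F2\<^esub>"] by (simp add: N1_def)
qed

lemma normal_N2: "N2 \<lhd> F2"
proof (rule F2.normal_invI)
  show "subgroup N2 F2"
  proof (rule F2.subgroupI)
    show "N2 \<noteq> {}" using one_G by (auto simp: N2_def)
    show "inv\<^bsub>F2\<^esub> b \<in> N2" if "b \<in> N2" for b using that G_inv by (fastforce simp: N2_def)
    show "b \<otimes>\<^bsub>F2\<^esub> d \<in> N2" if "b \<in> N2" "d \<in> N2" for b d using that G_mult by (fastforce simp: N2_def)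
  qed (auto simp: N2_def)
  fix b n assume b: "b \<in> carrier F2" and n: "n \<in> N2"
  obtain a where "a \<in> carrier F1" "(a, b) \<in> G" using b by (rule obtain_fst)
  with n show "b \<otimes>\<^bsub>F2\<^esub> n \<otimes>\<^bsub>F2\<^esub> inv\<^bsub>F2\<^esub> b \<in> N2"
    using b G_conj(1) [of a b "\<one>\<^bsub>F1\<^esub>" n] by (simp add: N2_def)
qed

text \<open>\<open>N1\<close> is the preimage of \<open>G\<close> under the embedding of
  \<open>F1\<close>. This embedding meets every coset of \<open>G\<close>: if
  \<open>(c, b) \<in> G\<close>, then \<open>(c^-1 a, 1)\<close> lies in the coset of
  \<open>(a, b)\<close>.\<close>

lemma bij_betw_rcosets_N1: "\<exists>f. bij_betw f (rcosets\<^bsub>F1\<^esub> N1) (rcosets\<^bsub>F1 \<times>\<times> F2\<^esub> G)"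
proof -
  have "group_hom F1 (F1 \<times>\<times> F2) (\<lambda>a. (a, \<one>\<^bsub>F2\<^esub>))"
    by (simp add: group_hom_def group_hom_axioms_def F1.is_group P.is_group hom_def)
  then show ?thesis
  proof (rule group_hom.bij_betw_rcosets_vimage [OF _ subgroup_G])
    fix y assume "y \<in> carrier (F1 \<times>\<times> F2)"
    then obtain a b where y: "y = (a, b)" "a \<in> carrier F1" "b \<in> carrier F2" by auto
    obtain c where c: "c \<in> carrier F1" "(c, b) \<in> G" using y(3) by (rule obtain_fst)
    have "(inv\<^bsub>F1\<^esub> c \<otimes>\<^bsub>F1\<^esub> a, \<one>\<^bsub>F2\<^esub>) \<in> G #>\<^bsub>F1 \<times>\<times> F2\<^esub> y"
      using P.rcosI [OF G_inv [OF c(2)] subgroup.subset [OF subgroup_G], of y] y by simp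
    then show "\<exists>x \<in> carrier F1. (x, \<one>\<^bsub>F2\<^esub>) \<in> G #>\<^bsub>F1 \<times>\<times> F2\<^esub> y"
      using c y by blast
  qed (simp add: N1_def)
qed

lemma bij_betw_rcosets_N2: "\<exists>f. bij_betw f (rcosets\<^bsub>F2\<^esub> N2) (rcosets\<^bsub>F1 \<times>\<times> F2\<^esub> G)"
proof -
  have "group_hom F2 (F1 \<times>\<times> F2) (\<lambda>b. (\<one>\<^bsub>F1\<^esub>, b))"
    by (simp add: group_hom_def group_hom_axioms_def F2.is_group P.is_group hom_def)
  then show ?thesis
  proof (rule group_hom.bij_betw_rcosets_vimage [OF _ subgroup_G])
    fix y assume "y \<in> carrier (F1 \<times>\<times> F2)"
    then obtain a b where y: "y = (a, b)" "a \<in> carrier F1" "b \<in> carrier F2" by auto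
    obtain c where c: "c \<in> carrier F2" "(a, c) \<in> G" using y(2) by (rule obtain_snd)
    have "(\<one>\<^bsub>F1\<^esub>, inv\<^bsub>F2\<^esub> c \<otimes>\<^bsub>F2\<^esub> b) \<in> G #>\<^bsub>F1 \<times>\<times> F2\<^esub> y"
      using P.rcosI [OF G_inv [OF c(2)] subgroup.subset [OF subgroup_G], of y] y by simp
    then show "\<exists>x \<in> carrier F2. (\<one>\<^bsub>F1\<^esub>, x) \<in> G #>\<^bsub>F1 \<times>\<times> F2\<^esub> y"
      using c y by blast
  qed (simp add: N2_def)
qed

lemma finite_p_group_N1_iff:
  assumes "finite (rcosets\<^bsub>F1 \<times>\<times> F2\<^esub> G)"
  shows "finite_p_group p (F1 Mod N1) \<longleftrightarrow> (\<exists>k. card (rcosets\<^bsub>F1 \<times>\<times> F2\<^esub> G) = p ^ k)"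
  using assms bij_betw_rcosets_N1 bij_betw_same_card bij_betw_finite
    normal.factorgroup_is_group [OF normal_N1]
  by (fastforce simp: finite_p_group_def order_def FactGroup_def)

lemma finite_p_group_N2_iff:
  assumes "finite (rcosets\<^bsub>F1 \<times>\<times> F2\<^esub> G)"
  shows "finite_p_group p (F2 Mod N2) \<longleftrightarrow> (\<exists>k. card (rcosets\<^bsub>F1 \<times>\<times> F2\<^esub> G) = p ^ k)"
  using assms bij_betw_rcosets_N2 bij_betw_same_card bij_betw_finite
    normal.factorgroup_is_group [OF normal_N2]
  by (fastforce simp: finite_p_group_def order_def FactGroup_def)

lemma conjugate_in_G_iff:
  assumes "(x1, x2) \<in> G"
  shows "conjugate_in ((F1 \<times>\<times> F2)\<lparr>carrier := G\<rparr>) (x1, x2) (y1, y2) \<longleftrightarrow>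
    (\<exists>a b. (a, b) \<in> G \<and> y1 = a \<otimes>\<^bsub>F1\<^esub> x1 \<otimes>\<^bsub>F1\<^esub> inv\<^bsub>F1\<^esub> a \<and> y2 = b \<otimes>\<^bsub>F2\<^esub> x2 \<otimes>\<^bsub>F2\<^esub> inv\<^bsub>F2\<^esub> b)"
proof -
  have "conjugate_in ((F1 \<times>\<times> F2)\<lparr>carrier := G\<rparr>) (x1, x2) (y1, y2) \<longleftrightarrow>
    (\<exists>(a, b) \<in> G. (y1, y2) = (a \<otimes>\<^bsub>F1\<^esub> x1 \<otimes>\<^bsub>F1\<^esub> inv\<^bsub>F1\<^esub> a, b \<otimes>\<^bsub>F2\<^esub> x2 \<otimes>\<^bsub>F2\<^esub> inv\<^bsub>F2\<^esub> b))"
    unfolding conjugate_in_def using G_conj(2) [OF _ assms]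
    by (intro bex_cong) (auto simp del: mult_DirProd monoid.simps)
  then show ?thesis by auto
qed

end

section \<open>Separability when \<open>F1 / N1\<close> is a finite \<open>p\<close>-group\<close>

lemma finite_p_group_DirProd:
  assumes "finite_p_group p A" "finite_p_group p B"
  shows "finite_p_group p (A \<times>\<times> B)"
proof -
  obtain j k where "order A = p ^ j" "order B = p ^ k"
    using assms by (auto simp: finite_p_group_def)
  then have "order (A \<times>\<times> B) = p ^ (j + k)"
    by (simp add: order_def DirProd_def card_cartesian_product power_add)
  then show ?thesis
    using assms by (auto simp: finite_p_group_def DirProd_def intro: DirProd_group [unfolded DirProd_def])
qed

lemma finite_p_group_subgroup:
  assumes "Factorial_Ring.prime p" "finite_p_group p A" "subgroup H A"
  shows "finite_p_group p (A\<lparr>carrier := H\<rparr>)"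
proof -
  interpret A: group A using assms(2) by (simp add: finite_p_group_def)
  obtain k where "order A = p ^ k" and fin: "finite (carrier A)"
    using assms(2) by (auto simp: finite_p_group_def)
  then have "card H dvd p ^ k"
    using A.lagrange [OF assms(3)] by (metis dvd_triv_right)
  then obtain i where "card H = p ^ i"
    using assms(1) by (metis divides_primepow_nat)
  then show ?thesis
    using A.subgroup_imp_group [OF assms(3)] fin subgroup.subset [OF assms(3)]
    by (auto simp: finite_p_group_def order_def finite_subset)
qed

context subdirect_subgroup
begin

text \<open>The quotient is taken modulo \<open>L1 \<times> L2\<close>, with both factors from
  \<open>conjugate_lift\<close>. A conjugation there by the image of \<open>(a, b)\<close> lifts in
  each coordinate, with corrections in \<open>N1\<close> and \<open>N2\<close>; as
  \<open>N1 \<times> N2\<close> lies in \<open>G\<close>, so does the corrected pair.\<close>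

lemma separable_if_finite_p_group:
  assumes p: "Factorial_Ring.prime p"
    and basis: "free_basis F1 S1" "free_basis F2 S2"
    and fin: "finite_p_group p (F1 Mod N1)" "finite_p_group p (F2 Mod N2)"
  shows "p_conjugacy_separable p ((F1 \<times>\<times> F2)\<lparr>carrier := G\<rparr>)"
  unfolding p_conjugacy_separable_def
proof (intro ballI impI)
  interpret B1: free_group_on F1 S1 by unfold_locales (rule basis)
  interpret B2: free_group_on F2 S2 by unfold_locales (rule basis)
  let ?G = "(F1 \<times>\<times> F2)\<lparr>carrier := G\<rparr>"
  fix x y assume "x \<in> carrier ?G" "y \<in> carrier ?G" and nonconj: "\<not> conjugate_in ?G x y"
  then obtain x1 x2 y1 y2 where x: "x = (x1, x2)" "(x1, x2) \<in> G" and y: "y = (y1, y2)" "(y1, y2) \<in> G"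
    by (cases x, cases y) auto
  obtain L1 where L1: "L1 \<lhd> F1" "L1 \<subseteq> N1" "finite_p_group p (F1 Mod L1)"
    and lift1: "\<And>a. a \<in> carrier F1 \<Longrightarrow> a \<otimes>\<^bsub>F1\<^esub> x1 \<otimes>\<^bsub>F1\<^esub> inv\<^bsub>F1\<^esub> a \<otimes>\<^bsub>F1\<^esub> inv\<^bsub>F1\<^esub> y1 \<in> L1 \<Longrightarrow>
      \<exists>h \<in> carrier F1. inv\<^bsub>F1\<^esub> a \<otimes>\<^bsub>F1\<^esub> h \<in> N1 \<and> h \<otimes>\<^bsub>F1\<^esub> x1 \<otimes>\<^bsub>F1\<^esub> inv\<^bsub>F1\<^esub> h = y1"
    using B1.conjugate_lift [OF p normal_N1 fin(1)] x y G_closed by metis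
  obtain L2 where L2: "L2 \<lhd> F2" "L2 \<subseteq> N2" "finite_p_group p (F2 Mod L2)"
    and lift2: "\<And>a. a \<in> carrier F2 \<Longrightarrow> a \<otimes>\<^bsub>F2\<^esub> x2 \<otimes>\<^bsub>F2\<^esub> inv\<^bsub>F2\<^esub> a \<otimes>\<^bsub>F2\<^esub> inv\<^bsub>F2\<^esub> y2 \<in> L2 \<Longrightarrow>
      \<exists>h \<in> carrier F2. inv\<^bsub>F2\<^esub> a \<otimes>\<^bsub>F2\<^esub> h \<in> N2 \<and> h \<otimes>\<^bsub>F2\<^esub> x2 \<otimes>\<^bsub>F2\<^esub> inv\<^bsub>F2\<^esub> h = y2"
    using B2.conjugate_lift [OF p normal_N2 fin(2)] x y G_closed by metis
  interpret L1: normal L1 F1 by (rule L1)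
  interpret L2: normal L2 F2 by (rule L2)
  interpret h1: group_hom F1 "F1 Mod L1" "(#>\<^bsub>F1\<^esub>) L1" by (rule L1.group_hom_Mod)
  interpret h2: group_hom F2 "F2 Mod L2" "(#>\<^bsub>F2\<^esub>) L2" by (rule L2.group_hom_Mod)
  define Q where "Q = (F1 Mod L1) \<times>\<times> (F2 Mod L2)"
  define \<pi> where "\<pi> = (\<lambda>(a, b). (L1 #>\<^bsub>F1\<^esub> a, L2 #>\<^bsub>F2\<^esub> b))"
  have Q: "finite_p_group p Q" unfolding Q_def using L1(3) L2(3) by (rule finite_p_group_DirProd)
  then have grQ: "group Q" by (simp add: finite_p_group_def)
  have hom: "\<pi> \<in> hom ?G Q"
  proof (rule homI)
    fix u assume "u \<in> carrier ?G"
    then show "\<pi> u \<in> carrier Q"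
      using G_closed h1.hom_closed h2.hom_closed by (cases u) (auto simp: \<pi>_def Q_def)
    fix v assume "v \<in> carrier ?G"
    then show "\<pi> (u \<otimes>\<^bsub>?G\<^esub> v) = \<pi> u \<otimes>\<^bsub>Q\<^esub> \<pi> v"
      using \<open>u \<in> carrier ?G\<close> G_closed h1.hom_mult h2.hom_mult
      by (cases u, cases v) (auto simp: \<pi>_def Q_def simp del: mult_FactGroup)
  qed
  interpret \<pi>: group_hom ?G Q \<pi>
    using grQ hom G.is_group by (simp add: group_hom_def group_hom_axioms_def)
  \<comment> \<open>The image of \<open>G\<close> and not all of \<open>Q\<close>: a conjugating
    element must come from \<open>G\<close>.\<close>
  let ?M = "Q\<lparr>carrier := \<pi> ` G\<rparr>"
  have sub: "subgroup (\<pi> ` G) Q" using \<pi>.img_is_subgroup by simp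
  have M: "finite_p_group p ?M" using p Q sub by (rule finite_p_group_subgroup)
  have "\<not> conjugate_in ?M (\<pi> x) (\<pi> y)"
  proof
    assume "conjugate_in ?M (\<pi> x) (\<pi> y)"
    then obtain g where g: "g \<in> G" and "\<pi> y = \<pi> g \<otimes>\<^bsub>Q\<^esub> \<pi> x \<otimes>\<^bsub>Q\<^esub> inv\<^bsub>?M\<^esub> \<pi> g"
      unfolding conjugate_in_def by auto
    then have eq: "\<pi> y = \<pi> g \<otimes>\<^bsub>Q\<^esub> \<pi> x \<otimes>\<^bsub>Q\<^esub> inv\<^bsub>Q\<^esub> \<pi> g"
      using group.m_inv_consistent [OF grQ sub, of "\<pi> g"] by simp
    obtain a b where ab: "g = (a, b)" "(a, b) \<in> G" using g by (cases g) auto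
    have "\<pi> (g \<otimes>\<^bsub>?G\<^esub> x \<otimes>\<^bsub>?G\<^esub> inv\<^bsub>?G\<^esub> g) = \<pi> y"
    proof -
      have "g \<in> carrier ?G" "x \<in> carrier ?G" using g x by simp_all
      then show ?thesis
        unfolding eq by (simp only: \<pi>.hom_mult \<pi>.hom_inv G.m_closed G.inv_closed)
    qed
    then have *: "\<pi> (a \<otimes>\<^bsub>F1\<^esub> x1 \<otimes>\<^bsub>F1\<^esub> inv\<^bsub>F1\<^esub> a, b \<otimes>\<^bsub>F2\<^esub> x2 \<otimes>\<^bsub>F2\<^esub> inv\<^bsub>F2\<^esub> b) = \<pi> (y1, y2)"
      unfolding ab(1) x(1) y(1) G_conj(2) [OF ab(2) x(2)] .
    note closed = G_closed [OF ab(2)] G_closed [OF x(2)] G_closed [OF y(2)]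
    have "a \<otimes>\<^bsub>F1\<^esub> x1 \<otimes>\<^bsub>F1\<^esub> inv\<^bsub>F1\<^esub> a \<otimes>\<^bsub>F1\<^esub> inv\<^bsub>F1\<^esub> y1 \<in> L1"
      "b \<otimes>\<^bsub>F2\<^esub> x2 \<otimes>\<^bsub>F2\<^esub> inv\<^bsub>F2\<^esub> b \<otimes>\<^bsub>F2\<^esub> inv\<^bsub>F2\<^esub> y2 \<in> L2"
      using * closed
      by (simp_all only: \<pi>_def prod.case prod.inject F1.r_coset_eq_iff F2.r_coset_eq_iff
          L1.subgroup_axioms L2.subgroup_axioms F1.m_closed F1.inv_closed F2.m_closed F2.inv_closed)
    then obtain a' b' where a': "a' \<in> carrier F1" "inv\<^bsub>F1\<^esub> a \<otimes>\<^bsub>F1\<^esub> a' \<in> N1" "a' \<otimes>\<^bsub>F1\<^esub> x1 \<otimes>\<^bsub>F1\<^esub> inv\<^bsub>F1\<^esub> a' = y1"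
      and b': "b' \<in> carrier F2" "inv\<^bsub>F2\<^esub> b \<otimes>\<^bsub>F2\<^esub> b' \<in> N2" "b' \<otimes>\<^bsub>F2\<^esub> x2 \<otimes>\<^bsub>F2\<^esub> inv\<^bsub>F2\<^esub> b' = y2"
      using lift1 lift2 closed by metis
    have "(a \<otimes>\<^bsub>F1\<^esub> (inv\<^bsub>F1\<^esub> a \<otimes>\<^bsub>F1\<^esub> a') \<otimes>\<^bsub>F1\<^esub> \<one>\<^bsub>F1\<^esub>, b \<otimes>\<^bsub>F2\<^esub> \<one>\<^bsub>F2\<^esub> \<otimes>\<^bsub>F2\<^esub> (inv\<^bsub>F2\<^esub> b \<otimes>\<^bsub>F2\<^esub> b')) \<in> G"
      using a'(2) b'(2) by (intro G_mult ab(2)) (simp_all add: N1_def N2_def)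
    then have "(a', b') \<in> G"
      using closed a'(1) b'(1) by (simp add: F1.inv_mult_cancel F2.inv_mult_cancel)
    with a'(3) b'(3) have "conjugate_in ?G x y"
      unfolding x(1) y(1) conjugate_in_G_iff [OF x(2)] by blast
    with nonconj show False by contradiction
  qed
  moreover have "\<pi> \<in> hom ?G ?M" using hom by (auto simp: hom_def)
  ultimately show "\<exists>(K :: nat monoid) \<psi>. finite_p_group p K \<and> \<psi> \<in> hom ?G K \<and> \<not> conjugate_in K (\<psi> x) (\<psi> y)"
    using x y by (intro finite_p_quotient_on_nat [OF M]) auto
qed

section \<open>Failure of separability when \<open>F1 / N1\<close> is not a
  \<open>p\<close>-group\<close>

lemma nat_pow_DirProd:
  assumes "a \<in> carrier F1" "b \<in> carrier F2"
  shows "(a, b) [^]\<^bsub>F1 \<times>\<times> F2\<^esub> (n::nat) = (a [^]\<^bsub>F1\<^esub> n, b [^]\<^bsub>F2\<^esub> n)"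
  by (induction n) simp_all

text \<open>If \<open>f\<close> has order \<open>n\<close> prime to \<open>p\<close> modulo \<open>N1\<close>, then in a finite \<open>p\<close>-group the image of
  \<open>(f, g)\<close> equals the image of some power \<open>(f, g)\<^sup>r\<close> with \<open>n\<close> dividing \<open>r\<close>, and this power
  is the product of \<open>(f\<^sup>r, 1)\<close> and \<open>(1, g\<^sup>r)\<close>, both in \<open>G\<close>.\<close>

lemma conjugate_in_p_quotients:
  assumes p: "Factorial_Ring.prime p" and M: "finite_p_group p M"
    and hom: "\<phi> \<in> hom ((F1 \<times>\<times> F2)\<lparr>carrier := G\<rparr>) M"
    and f: "f \<in> carrier F1" "f [^]\<^bsub>F1\<^esub> (n::nat) \<in> N1" "coprime n p"
    and x: "x1 \<in> N1" "x2 \<in> N2"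
  shows "conjugate_in M (\<phi> (x1, x2)) (\<phi> (f \<otimes>\<^bsub>F1\<^esub> x1 \<otimes>\<^bsub>F1\<^esub> inv\<^bsub>F1\<^esub> f, x2))"
proof -
  let ?G = "(F1 \<times>\<times> F2)\<lparr>carrier := G\<rparr>"
  interpret M: group M using M by (simp add: finite_p_group_def)
  interpret \<phi>: group_hom ?G M \<phi>
    using hom G.is_group M.is_group by (simp add: group_hom_def group_hom_axioms_def)
  obtain k where k: "order M = p ^ k" using M by (auto simp: finite_p_group_def)
  have "n \<noteq> 0" using f(3) p by (metis coprime_0_left_iff not_prime_unit)
  \<comment> \<open>Bezout gives a multiple of \<open>n\<close> that is 1 modulo the order of
    \<open>M\<close>; raising to this power changes nothing in \<open>M\<close>.\<close>
  then obtain n' j where "n * n' = p ^ k * j + gcd n (p ^ k)" using bezout_nat by blast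
  moreover have "gcd n (p ^ k) = 1" using f(3) by (simp flip: coprime_iff_gcd_eq_1)
  ultimately have r: "n * n' = p ^ k * j + 1" by simp
  define r where "r = n * n'"
  obtain g where g: "g \<in> carrier F2" "(f, g) \<in> G" using f(1) by (rule obtain_snd)
  have frN: "f [^]\<^bsub>F1\<^esub> r \<in> N1"
    using F1.subgroup_nat_pow_closed [OF normal.axioms(1) [OF normal_N1] f(2), of n'] f(1)
    by (simp add: F1.nat_pow_pow r_def)
  have pow: "(f, g) [^]\<^bsub>?G\<^esub> m = (f [^]\<^bsub>F1\<^esub> m, g [^]\<^bsub>F2\<^esub> m)" for m :: nat
    using nat_pow_DirProd [OF f(1) g(1)] by (simp flip: P.nat_pow_consistent)
  have fg: "(f, g) \<in> carrier ?G" using g by simp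
  have powG: "(f [^]\<^bsub>F1\<^esub> r, g [^]\<^bsub>F2\<^esub> r) \<in> G"
    using G.nat_pow_closed [OF fg, of r] by (simp add: pow)
  have "\<phi> (f [^]\<^bsub>F1\<^esub> r, g [^]\<^bsub>F2\<^esub> r) = \<phi> (f, g) [^]\<^bsub>M\<^esub> r"
    using \<phi>.hom_nat_pow [OF fg] by (simp add: pow)
  also have "\<dots> = (\<phi> (f, g) [^]\<^bsub>M\<^esub> order M) [^]\<^bsub>M\<^esub> j \<otimes>\<^bsub>M\<^esub> \<phi> (f, g)"
  proof -
    have "r = Suc (order M * j)" by (simp add: r_def r k)
    then show ?thesis by (simp only: M.nat_pow_Suc M.nat_pow_pow [OF \<phi>.hom_closed [OF fg]])
  qed
  also have "\<dots> = \<phi> (f, g)" using \<phi>.hom_closed [OF fg] by (simp add: M.pow_order_eq_1)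
  finally have same: "\<phi> (f [^]\<^bsub>F1\<^esub> r, g [^]\<^bsub>F2\<^esub> r) = \<phi> (f, g)" .
  define e where "e = (f [^]\<^bsub>F1\<^esub> r, \<one>\<^bsub>F2\<^esub>)"
  have e: "e \<in> G" using frN by (simp add: e_def N1_def)
  have x1: "x1 \<in> carrier F1" "(x1, \<one>\<^bsub>F2\<^esub>) \<in> G" and x2: "x2 \<in> carrier F2" "(\<one>\<^bsub>F1\<^esub>, x2) \<in> G"
    using x by (simp_all add: N1_def N2_def)
  have hom_conj: "\<phi> (a \<otimes>\<^bsub>F1\<^esub> u \<otimes>\<^bsub>F1\<^esub> inv\<^bsub>F1\<^esub> a, b \<otimes>\<^bsub>F2\<^esub> v \<otimes>\<^bsub>F2\<^esub> inv\<^bsub>F2\<^esub> b)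
      = \<phi> (a, b) \<otimes>\<^bsub>M\<^esub> \<phi> (u, v) \<otimes>\<^bsub>M\<^esub> inv\<^bsub>M\<^esub> \<phi> (a, b)" if "(a, b) \<in> G" "(u, v) \<in> G" for a b u v
  proof -
    have "(a, b) \<in> carrier ?G" "(u, v) \<in> carrier ?G" using that by simp_all
    then show ?thesis
      unfolding G_conj(2) [OF that, symmetric] by (simp only: \<phi>.hom_mult \<phi>.hom_inv G.m_closed G.inv_closed)
  qed
  \<comment> \<open>The factor \<open>x2\<close> is split off because \<open>(f, g)\<close> would
    conjugate it as well.\<close>
  have hom_split: "\<phi> (a, v) = \<phi> (a, \<one>\<^bsub>F2\<^esub>) \<otimes>\<^bsub>M\<^esub> \<phi> (\<one>\<^bsub>F1\<^esub>, v)"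
    if "(a, \<one>\<^bsub>F2\<^esub>) \<in> G" "(\<one>\<^bsub>F1\<^esub>, v) \<in> G" for a v
    using \<phi>.hom_mult [of "(a, \<one>\<^bsub>F2\<^esub>)" "(\<one>\<^bsub>F1\<^esub>, v)"] that G_closed [OF that(1)] G_closed [OF that(2)] by simp
  define f' where "f' = f [^]\<^bsub>F1\<^esub> r"
  have f': "f' \<in> carrier F1" using f(1) by (simp add: f'_def)
  have one_conj: "b \<otimes>\<^bsub>F2\<^esub> \<one>\<^bsub>F2\<^esub> \<otimes>\<^bsub>F2\<^esub> inv\<^bsub>F2\<^esub> b = \<one>\<^bsub>F2\<^esub>" if "b \<in> carrier F2" for b using that by simp
  have grF: "g [^]\<^bsub>F2\<^esub> r \<in> carrier F2" using g(1) by simp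
  have in_G: "(f \<otimes>\<^bsub>F1\<^esub> x1 \<otimes>\<^bsub>F1\<^esub> inv\<^bsub>F1\<^esub> f, \<one>\<^bsub>F2\<^esub>) \<in> G" "(f' \<otimes>\<^bsub>F1\<^esub> x1 \<otimes>\<^bsub>F1\<^esub> inv\<^bsub>F1\<^esub> f', \<one>\<^bsub>F2\<^esub>) \<in> G"
    using G_conj(1) [OF g(2) x1(2)] G_conj(1) [OF powG x1(2)]
    unfolding one_conj [OF g(1)] one_conj [OF grF] f'_def by blast+
  have "\<phi> (f \<otimes>\<^bsub>F1\<^esub> x1 \<otimes>\<^bsub>F1\<^esub> inv\<^bsub>F1\<^esub> f, \<one>\<^bsub>F2\<^esub>) = \<phi> (f' \<otimes>\<^bsub>F1\<^esub> x1 \<otimes>\<^bsub>F1\<^esub> inv\<^bsub>F1\<^esub> f', \<one>\<^bsub>F2\<^esub>)"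
    using hom_conj [OF g(2) x1(2)] hom_conj [OF powG x1(2)]
    unfolding one_conj [OF g(1)] one_conj [OF grF] f'_def same by simp
  then have "\<phi> (f \<otimes>\<^bsub>F1\<^esub> x1 \<otimes>\<^bsub>F1\<^esub> inv\<^bsub>F1\<^esub> f, x2) = \<phi> (f' \<otimes>\<^bsub>F1\<^esub> x1 \<otimes>\<^bsub>F1\<^esub> inv\<^bsub>F1\<^esub> f', x2)"
    using hom_split [OF in_G(1) x2(2)] hom_split [OF in_G(2) x2(2)] by simp
  also have "\<dots> = \<phi> e \<otimes>\<^bsub>M\<^esub> \<phi> (x1, x2) \<otimes>\<^bsub>M\<^esub> inv\<^bsub>M\<^esub> \<phi> e"
  proof -
    have "(x1, x2) \<in> G" using G_mult [OF x1(2) x2(2)] x1(1) x2(1) by simp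
    from hom_conj [OF e [unfolded e_def] this] show ?thesis
      using x2(1) by (simp add: e_def f'_def)
  qed
  finally show ?thesis
    unfolding conjugate_in_def using \<phi>.hom_closed [of e] e by auto
qed

text \<open>If \<open>(a, b)\<close> in \<open>G\<close> conjugated \<open>(x1, x2)\<close> to
  \<open>(f x1 f^-1, x2)\<close>, then \<open>b\<close> would centralize \<open>x2\<close>, so
  \<open>b \<in> N2\<close> and therefore \<open>a \<in> N1\<close>. Also \<open>f^-1 a\<close>
  would centralize \<open>x1\<close>, so it would lie in \<open>N1\<close>. Together this gives
  \<open>f \<in> N1\<close>, against the choice of \<open>f\<close>.\<close>

lemma finite_p_group_if_separable:
  assumes p: "Factorial_Ring.prime p"
    and basis: "free_basis F1 S1" "free_basis F2 S2"
    and nonab: "\<not> comm_group F1" "\<not> comm_group F2"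
    and fin: "finite (rcosets\<^bsub>F1\<^esub> N1)" "finite (rcosets\<^bsub>F2\<^esub> N2)"
    and sep: "p_conjugacy_separable p ((F1 \<times>\<times> F2)\<lparr>carrier := G\<rparr>)"
  shows "finite_p_group p (F1 Mod N1)"
proof (rule ccontr)
  let ?G = "(F1 \<times>\<times> F2)\<lparr>carrier := G\<rparr>"
  interpret B1: free_group_on F1 S1 by unfold_locales (rule basis)
  interpret B2: free_group_on F2 S2 by unfold_locales (rule basis)
  interpret N1: normal N1 F1 by (rule normal_N1)
  interpret N2: normal N2 F2 by (rule normal_N2)
  interpret Q: group "F1 Mod N1" by (rule N1.factorgroup_is_group)
  assume not_p: "\<not> finite_p_group p (F1 Mod N1)"
  have "finite (carrier (F1 Mod N1))" using fin(1) by (simp add: FactGroup_def)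
  moreover from this not_p have "\<nexists>k. order (F1 Mod N1) = p ^ k"
    by (auto simp: finite_p_group_def Q.is_group)
  ultimately obtain c n where c: "c \<in> carrier (F1 Mod N1)" "c \<noteq> \<one>\<^bsub>F1 Mod N1\<^esub>"
    "c [^]\<^bsub>F1 Mod N1\<^esub> (n::nat) = \<one>\<^bsub>F1 Mod N1\<^esub>" "coprime n p"
    using Q.exists_coprime_order [OF p] by metis
  obtain f where f: "f \<in> carrier F1" "c = N1 #>\<^bsub>F1\<^esub> f" using c(1) by (auto simp: carrier_FactGroup)
  have f_n: "f [^]\<^bsub>F1\<^esub> n \<in> N1" using c(3) f N1.r_coset_pow_eq_one_iff by blast
  have f_N: "f \<notin> N1" using c(2) f F1.coset_join2 [OF _ N1.subgroup_axioms] by auto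
  obtain x1 where x1: "x1 \<in> N1" "\<And>g. g \<in> carrier F1 \<Longrightarrow> g \<otimes>\<^bsub>F1\<^esub> x1 = x1 \<otimes>\<^bsub>F1\<^esub> g \<Longrightarrow> g \<in> N1"
    using B1.exists_small_centralizer [OF nonab(1) normal_N1 fin(1)] by blast
  obtain x2 where x2: "x2 \<in> N2" "\<And>g. g \<in> carrier F2 \<Longrightarrow> g \<otimes>\<^bsub>F2\<^esub> x2 = x2 \<otimes>\<^bsub>F2\<^esub> g \<Longrightarrow> g \<in> N2"
    using B2.exists_small_centralizer [OF nonab(2) normal_N2 fin(2)] by blast
  have closed: "x1 \<in> carrier F1" "x2 \<in> carrier F2" 
    by (rule N1.mem_carrier [OF x1(1)], rule N2.mem_carrier [OF x2(1)])
  let ?y1 = "f \<otimes>\<^bsub>F1\<^esub> x1 \<otimes>\<^bsub>F1\<^esub> inv\<^bsub>F1\<^esub> f"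
  have x: "(x1, x2) \<in> G" and y: "(?y1, x2) \<in> G"
    using x1(1) x2(1) N1.inv_op_closed2 [OF f(1)] by (blast intro: N1_times_N2)+
  have "\<not> conjugate_in ?G (x1, x2) (?y1, x2)"
  proof
    assume "conjugate_in ?G (x1, x2) (?y1, x2)"
    then obtain a b where ab: "(a, b) \<in> G" "?y1 = a \<otimes>\<^bsub>F1\<^esub> x1 \<otimes>\<^bsub>F1\<^esub> inv\<^bsub>F1\<^esub> a"
      "x2 = b \<otimes>\<^bsub>F2\<^esub> x2 \<otimes>\<^bsub>F2\<^esub> inv\<^bsub>F2\<^esub> b"
      unfolding conjugate_in_G_iff [OF x] by blast
    have a: "a \<in> carrier F1" and b: "b \<in> carrier F2" using ab(1) by (rule G_closed)+
    have "b \<otimes>\<^bsub>F2\<^esub> x2 = b \<otimes>\<^bsub>F2\<^esub> x2 \<otimes>\<^bsub>F2\<^esub> inv\<^bsub>F2\<^esub> b \<otimes>\<^bsub>F2\<^esub> b"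
      using b closed by (simp add: F2.m_assoc)
    then have "b \<in> N2" unfolding ab(3) [symmetric] by (rule x2(2) [OF b])
    then have "(\<one>\<^bsub>F1\<^esub>, inv\<^bsub>F2\<^esub> b) \<in> G"
      using N2.m_inv_closed by (simp flip: N2_iff)
    from G_mult [OF ab(1) this] have "a \<in> N1" using a b by (simp add: N1_iff)
    let ?d = "inv\<^bsub>F1\<^esub> f \<otimes>\<^bsub>F1\<^esub> a"
    have "inv\<^bsub>F1\<^esub> f \<otimes>\<^bsub>F1\<^esub> ?y1 \<otimes>\<^bsub>F1\<^esub> a = inv\<^bsub>F1\<^esub> f \<otimes>\<^bsub>F1\<^esub> (a \<otimes>\<^bsub>F1\<^esub> x1 \<otimes>\<^bsub>F1\<^esub> inv\<^bsub>F1\<^esub> a) \<otimes>\<^bsub>F1\<^esub> a"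
      using ab(2) by simp
    then have "?d \<otimes>\<^bsub>F1\<^esub> x1 = x1 \<otimes>\<^bsub>F1\<^esub> ?d"
      using f(1) a closed by (simp add: F1.m_assoc F1.inv_mult_cancel)
    then have "?d \<in> N1" using f(1) a by (intro x1(2)) auto
    then have "a \<otimes>\<^bsub>F1\<^esub> inv\<^bsub>F1\<^esub> ?d \<in> N1"
      using \<open>a \<in> N1\<close> by (blast intro: N1.m_closed N1.m_inv_closed)
    then have "f \<in> N1"
      using f(1) a by (simp add: F1.inv_mult_group F1.inv_mult_cancel)
    with f_N show False by contradiction
  qed
  then obtain M :: "nat monoid" and \<phi> where "finite_p_group p M" "\<phi> \<in> hom ?G M"
    "\<not> conjugate_in M (\<phi> (x1, x2)) (\<phi> (?y1, x2))"
    using sep x y unfolding p_conjugacy_separable_def by fastforce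
  then show False
    using conjugate_in_p_quotients [OF p _ _ f(1) f_n c(4) x1(1) x2(1)] by blast
qed

end

theorem corollary4p13:
  fixes p :: nat
    and F1 :: "('a, 'm) monoid_scheme"
    and F2 :: "('b, 'n) monoid_scheme"
    and G :: "('a \<times> 'b) set"
  assumes "Factorial_Ring.prime p"
    and "is_free_group F1" and "\<not> comm_group F1"
    and "is_free_group F2" and "\<not> comm_group F2"
    and "subdirect_product F1 F2 G"
    and "finite (rcosets\<^bsub>F1 \<times>\<times> F2\<^esub> G)"
  shows "(p_conjugacy_separable p ((F1 \<times>\<times> F2)\<lparr>carrier := G\<rparr>) \<longleftrightarrow>
            finite_p_group p (F1 Mod meet_fst_factor F1 F2 G)) \<and>
         (finite_p_group p (F1 Mod meet_fst_factor F1 F2 G) \<longleftrightarrow>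
            (\<exists>k. card (rcosets\<^bsub>F1 \<times>\<times> F2\<^esub> G) = p ^ k))"
proof -
  interpret subdirect_subgroup F1 F2 G
    using assms by (simp add: is_free_group_def subdirect_subgroup_def subdirect_subgroup_axioms_def)
  obtain S1 S2 where basis: "free_basis F1 S1" "free_basis F2 S2"
    using assms by (auto simp: is_free_group_def)
  have fin: "finite (rcosets\<^bsub>F1\<^esub> N1)" "finite (rcosets\<^bsub>F2\<^esub> N2)"
    using bij_betw_rcosets_N1 bij_betw_rcosets_N2 bij_betw_finite assms(7) by blast+
  \<comment> \<open>Both quotients have the index of \<open>G\<close> as their order.\<close>
  have N2: "finite_p_group p (F2 Mod N2)" if "finite_p_group p (F1 Mod N1)"
    using that finite_p_group_N1_iff [OF assms(7)] finite_p_group_N2_iff [OF assms(7)] by simp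
  have "p_conjugacy_separable p ((F1 \<times>\<times> F2)\<lparr>carrier := G\<rparr>) \<longleftrightarrow> finite_p_group p (F1 Mod N1)"
    using finite_p_group_if_separable [OF assms(1) basis assms(3,5) fin]
      separable_if_finite_p_group [OF assms(1) basis] N2 by blast
  then show ?thesis
    unfolding meet_fst_factor_eq using finite_p_group_N1_iff [OF assms(7)] by simp
qed

end
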